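(* Let $x_0=x_1\in\mathbb{R}^n$ and assume exactness. Let $\{x_k\}_{k\ge 0}$ be the random iterates produced by the method mSGD/mSN/mSPP with stepsize $\omega$ and momentum parameter $\beta$. Assume $0<\omega<2$ and $\beta\ge 0$ and that the expressions $$a_1:=1+3\beta+2\beta^2-(\omega(2-\omega)+\omega\beta)\lambda_{\min}^+,\qquad a_2:=\beta+2\beta^2+\omega\beta\lambda_{\max}$$ satisfy $a_1+a_2<1$. Let $x_*=\Pi^{\mathbf{B}}_{\mathcal{L}}(x_0)$, $q:=\frac{a_1+\sqrt{a_1^2+4a_2}}{2}$ and $\delta:=q-a_1$. Then for all $k\ge 0$ $$\mathbb{E}\left[\|x_{k+1}-x_*\|_{\mathbf{B}}^2\right]\le q^k(1+\delta)\|x_0-x_*\|_{\mathbf{B}}^2$$ and $$\mathbb{E}[f(x_{k+1})]\le q^k\,\frac{\lambda_{\max}}{2}(1+\delta)\|x_0-x_*\|_{\mathbf{B}}^2 .$$ Moreover, $a_1+a_2\le q<1$.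
   Context: Let $\mathbf{A}\in\mathbb{R}^{m\times n}$ and $b\in\mathbb{R}^m$ be such that the linear system $\mathbf{A}x=b$ is consistent, with solution set $\mathcal{L}=\{x\in\mathbb{R}^n:\mathbf{A}x=b\}$. Let $\mathbf{B}\in\mathbb{R}^{n\times n}$ be symmetric positive definite, $\langle x,z\rangle_{\mathbf{B}}:=x^\top\mathbf{B}z$, $\|x\|_{\mathbf{B}}:=(x^\top\mathbf{B}x)^{1/2}$; $\Pi^{\mathbf{B}}_{\mathcal{L}}(x)$ is the projection of $x$ onto $\mathcal{L}$ in the norm $\|\cdot\|_{\mathbf{B}}$. Let $\mathcal{D}$ be an arbitrary probability distribution over real matrices $\mathbf{S}$ with $m$ rows. For such $\mathbf{S}$ define $$\mathbf{H}:=\mathbf{S}(\mathbf{S}^\top\mathbf{A}\mathbf{B}^{-1}\mathbf{A}^\top\mathbf{S})^\dagger\mathbf{S}^\top,\quad \mathbf{Z}:=\mathbf{A}^\top\mathbf{H}\mathbf{A},\quad f_{\mathbf{S}}(x):=\tfrac12(\mathbf{A}x-b)^\top\mathbf{H}(\mathbf{A}x-b),$$ where $\dagger$ is the Moore–Penrose pseudoinverse, and $f(x):=\mathbb{E}_{\mathbf{S}\sim\mathcal{D}}[f_{\mathbf{S}}(x)]$. Gradients are with respect to $\langle\cdot,\cdot\rangle_{\mathbf{B}}$, so $\nabla f_{\mathbf{S}}(x)=\mathbf{B}^{-1}\mathbf{A}^\top\mathbf{H}(\mathbf{A}x-b)$. Let $\mathbf{W}:=\mathbf{B}^{-1/2}\mathbb{E}[\mathbf{Z}]\mathbf{B}^{-1/2}$;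 $\lambda_{\max}$ is its largest eigenvalue and $\lambda_{\min}^+$ its smallest nonzero eigenvalue (it is presupposed that $\mathbf{W}\neq 0$, so that this is defined). Exactness means: the set of minimizers of $f$ equals $\mathcal{L}$. The method mSGD/mSN/mSPP (one and the same iteration) with stepsize $\omega$ and momentum parameter $\beta$: given deterministic $x_0,x_1\in\mathbb{R}^n$, for each $k\ge 1$ draw a fresh independent $\mathbf{S}_k\sim\mathcal{D}$ and set $$x_{k+1}=x_k-\omega\nabla f_{\mathbf{S}_k}(x_k)+\beta(x_k-x_{k-1}).$$ *)

theory Defs
  imports
    "HOL-Probability.Probability"
    "Jordan_Normal_Form.Char_Poly"
    "Jordan_Normal_Form.Gauss_Jordan_Elimination"
begin

definition spd_mat :: "nat \<Rightarrow> real mat \<Rightarrow> bool" where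
  "spd_mat n B \<longleftrightarrow> B \<in> carrier_mat n n \<and> transpose_mat B = B \<and>
     (\<forall>v \<in> carrier_vec n. v \<noteq> 0\<^sub>v n \<longrightarrow> scalar_prod v (B *\<^sub>v v) > 0)"

abbreviation mat_inv :: "real mat \<Rightarrow> real mat" where
  "mat_inv B \<equiv> the (mat_inverse B)"

definition spd_sqrt :: "nat \<Rightarrow> real mat \<Rightarrow> real mat" where
  "spd_sqrt n B = (THE R. spd_mat n R \<and> R * R = B)"

definition is_pinv :: "real mat \<Rightarrow> real mat \<Rightarrow> bool" where
  "is_pinv M X \<longleftrightarrow> X \<in> carrier_mat (dim_col M) (dim_row M) \<and>
     M * X * M = M \<and> X * M * X = X \<and>
     transpose_mat (M * X) = M * X \<and> transpose_mat (X * M) = X * M"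

definition pinv :: "real mat \<Rightarrow> real mat" where
  "pinv M = (THE X. is_pinv M X)"

definition ip_B :: "real mat \<Rightarrow> real vec \<Rightarrow> real vec \<Rightarrow> real" where
  "ip_B B x z = scalar_prod x (B *\<^sub>v z)"

definition norm_B :: "real mat \<Rightarrow> real vec \<Rightarrow> real" where
  "norm_B B x = sqrt (ip_B B x x)"

definition sol_set :: "nat \<Rightarrow> real mat \<Rightarrow> real vec \<Rightarrow> real vec set" where
  "sol_set n A b = {x \<in> carrier_vec n. A *\<^sub>v x = b}"

definition proj_B :: "real mat \<Rightarrow> real vec set \<Rightarrow> real vec \<Rightarrow> real vec" where
  "proj_B B L x = arg_min_on (\<lambda>z. norm_B B (z - x)) L"

(* The Borel sigma-algebra of the disjoint union, over all column counts q, of the Euclidean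
   spaces of real m x q matrices: a distribution may thus charge matrices of different widths. *)
definition mat_borel :: "nat \<Rightarrow> real mat measure" where
  "mat_borel m = sigma {S. dim_row S = m}
     (range (carrier_mat m) \<union>
      {{S \<in> carrier_mat m q. S $$ (i, j) \<le> a} | q i j a. i < m \<and> j < q})"

definition H_mat :: "real mat \<Rightarrow> real mat \<Rightarrow> real mat \<Rightarrow> real mat" where
  "H_mat A B S =
     S * pinv (transpose_mat S * A * mat_inv B * transpose_mat A * S) * transpose_mat S"

definition Z_mat :: "real mat \<Rightarrow> real mat \<Rightarrow> real mat \<Rightarrow> real mat" where
  "Z_mat A B S = transpose_mat A * H_mat A B S * A"

definition f_sketch :: "real mat \<Rightarrow> real mat \<Rightarrow> real vec \<Rightarrow> real mat \<Rightarrow> real vec \<Rightarrow> real" where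
  "f_sketch A B b S x = 1 / 2 * scalar_prod (A *\<^sub>v x - b) (H_mat A B S *\<^sub>v (A *\<^sub>v x - b))"

(* For a consistent system the integrand is a bounded function of S: it equals
   (1/2) (x - y)^T Z (x - y) for any solution y, and B^(-1/2) Z B^(-1/2) is an orthogonal
   projection.  The same bound applies to the entries of Z in EZ_mat below. *)
definition f_full ::
  "real mat measure \<Rightarrow> real mat \<Rightarrow> real mat \<Rightarrow> real vec \<Rightarrow> real vec \<Rightarrow> real" where
  "f_full D A B b x = (\<integral>S. f_sketch A B b S x \<partial>D)"

(* The gradient of f_sketch A B b S with respect to the inner product ip_B B. *)
definition grad_sketch ::
  "real mat \<Rightarrow> real mat \<Rightarrow> real vec \<Rightarrow> real mat \<Rightarrow> real vec \<Rightarrow> real vec" where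
  "grad_sketch A B b S x =
     (mat_inv B * transpose_mat A * H_mat A B S) *\<^sub>v (A *\<^sub>v x - b)"

definition EZ_mat :: "nat \<Rightarrow> real mat measure \<Rightarrow> real mat \<Rightarrow> real mat \<Rightarrow> real mat" where
  "EZ_mat n D A B = mat n n (\<lambda>(i, j). \<integral>S. Z_mat A B S $$ (i, j) \<partial>D)"

definition W_mat :: "nat \<Rightarrow> real mat measure \<Rightarrow> real mat \<Rightarrow> real mat \<Rightarrow> real mat" where
  "W_mat n D A B = mat_inv (spd_sqrt n B) * EZ_mat n D A B * mat_inv (spd_sqrt n B)"

definition lambda_max :: "real mat \<Rightarrow> real" where
  "lambda_max W = Max {l. eigenvalue W l}"

definition lambda_min_plus :: "real mat \<Rightarrow> real" where
  "lambda_min_plus W = Min {l. eigenvalue W l \<and> l \<noteq> 0}"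

definition exactness ::
  "nat \<Rightarrow> real mat measure \<Rightarrow> real mat \<Rightarrow> real mat \<Rightarrow> real vec \<Rightarrow> bool" where
  "exactness n D A B b \<longleftrightarrow>
     {x \<in> carrier_vec n. \<forall>y \<in> carrier_vec n. f_full D A B b x \<le> f_full D A B b y} = sol_set n A b"

(* A sample path of the method along the realised sketches s 1, s 2, ...; s 0 is never used. *)
fun msgd :: "real mat \<Rightarrow> real mat \<Rightarrow> real vec \<Rightarrow> real \<Rightarrow> real \<Rightarrow> real vec \<Rightarrow> real vec \<Rightarrow>
    (nat \<Rightarrow> real mat) \<Rightarrow> nat \<Rightarrow> real vec" where
  "msgd A B b \<omega> \<beta> x0 x1 s 0 = x0"
| "msgd A B b \<omega> \<beta> x0 x1 s (Suc 0) = x1"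
| "msgd A B b \<omega> \<beta> x0 x1 s (Suc (Suc k)) =
     msgd A B b \<omega> \<beta> x0 x1 s (Suc k)
     - \<omega> \<cdot>\<^sub>v grad_sketch A B b (s (Suc k)) (msgd A B b \<omega> \<beta> x0 x1 s (Suc k))
     + \<beta> \<cdot>\<^sub>v (msgd A B b \<omega> \<beta> x0 x1 s (Suc k) - msgd A B b \<omega> \<beta> x0 x1 s k)"

end

theory Submission
  imports Defs "Jordan_Normal_Form.Spectral_Radius"
begin

text \<open>
Write \<open>|\<cdot>|\<close> for the \<open>B\<close>-norm, and \<open>d'\<close>, \<open>d\<close>, \<open>e\<close> for the errors \<open>x - xstar\<close> of three consecutive
iterates, the newest first. Since \<open>xstar\<close> solves the system, a sketch enters only through
\<open>Z = A\<^sup>T H A\<close>: the iteration is \<open>d' = d - \<omega> B\<inverse> Z d + \<beta> (d - e)\<close>, and the sketched objective is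
\<open>d\<^sup>T Z d / 2\<close>. The matrix \<open>B\<inverse> Z\<close> is a \<open>B\<close>-orthogonal projection, so \<open>Z B\<inverse> Z = Z\<close>. Expanding the
square with this identity, and discarding two nonnegative quadratic forms, gives on every sample path
(\<open>momentum_step\<close>)

\<open>|d'|\<^sup>2 \<le> (1 + 3\<beta> + 2\<beta>\<^sup>2) |d|\<^sup>2 + (\<beta> + 2\<beta>\<^sup>2) |e|\<^sup>2 - (\<omega>(2 - \<omega>) + \<omega>\<beta>) d\<^sup>T Z d + \<omega>\<beta> e\<^sup>T Z e\<close>.

The sketch in this step is independent of \<open>d\<close> and \<open>e\<close>, so under the expectation \<open>Z\<close> may be replaced
by \<open>E[Z]\<close> (\<open>expected_Z_form\<close>). Let \<open>R\<close> be the square root of \<open>B\<close>. Diagonalizing \<open>W = R\<inverse> E[Z] R\<inverse>\<close>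
yields \<open>d\<^sup>T E[Z] d \<le> lmax |d|\<^sup>2\<close> for all \<open>d\<close>, and \<open>lmin |d|\<^sup>2 \<le> d\<^sup>T E[Z] d\<close> provided that \<open>R d\<close> is
orthogonal to the kernel of \<open>W\<close>. By exactness, this proviso follows from \<open>B\<close>-orthogonality of \<open>d\<close> to
the kernel of \<open>A\<close>. The initial error has that property because \<open>xstar\<close> is a projection, and the
iteration preserves it (\<open>err_kernel_orthogonal\<close>).

Altogether the mean square error \<open>F k\<close> of the \<open>k\<close>-th iterate satisfies
\<open>F (k + 2) \<le> a1 F (k + 1) + a2 F k\<close>. As \<open>q\<close> is the larger root of \<open>t\<^sup>2 = a1 t + a2\<close>, the combination
\<open>F (k + 1) + \<delta> F k\<close> decreases at least by the factor \<open>q\<close> in each step (\<open>momentum_recurrence\<close>). The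
bound on the objective follows, because its expected value at the \<open>k\<close>-th iterate is half the
expectation of \<open>d\<^sup>T E[Z] d\<close>, hence at most \<open>lmax / 2 * F k\<close>.

Two ingredients need more work than this outline suggests. The square root of \<open>B\<close>, the
pseudoinverses and the eigenvalue bounds all rest on the spectral theorem
(\<open>real_symmetric_diagonalization\<close>). And the expectations make sense because \<open>Z\<close> is a bounded
measurable function of the sketch \<open>S\<close>. Boundedness follows from \<open>0 \<le> v\<^sup>T Z v \<le> v\<^sup>T B v\<close>; as the
starting point is deterministic, each iterate is then bounded too. For measurability, the
pseudoinverse, which is not continuous, is eliminated by writing \<open>v\<^sup>T Z v\<close> as a countable supremum of
functions that are polynomial in the entries of \<open>S S\<^sup>T\<close> (\<open>Z_less_iff_sup_form\<close>).
\<close>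

section \<open>Diagonalization of real symmetric matrices\<close>

text \<open>Moving the matrix from one side of the Hermitian product to the other replaces the eigenvalue by
its conjugate.\<close>

lemma symmetric_complex_eigenvalue_real:
  fixes M :: "real mat"
  assumes M: "M \<in> carrier_mat n n" and sym: "transpose_mat M = M"
    and ev: "eigenvalue (map_mat complex_of_real M) e"
  shows "Im e = 0"
proof -
  let ?C = "map_mat complex_of_real M"
  have C: "?C \<in> carrier_mat n n" using M by auto
  from ev obtain v where v: "v \<in> carrier_vec n" "v \<noteq> 0\<^sub>v n" "?C *\<^sub>v v = e \<cdot>\<^sub>v v"
    unfolding eigenvalue_def eigenvector_def using C by auto
  have Ct: "transpose_mat ?C = ?C" using sym by (metis map_mat_transpose)
  have conj: "conjugate (?C *\<^sub>v v) = ?C *\<^sub>v conjugate v"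
    by (rule eq_vecI) (use C v(1) M in \<open>auto simp: scalar_prod_def cnj_sum\<close>)
  have "e * (v \<bullet>c v) = (e \<cdot>\<^sub>v v) \<bullet>c v" using v by simp
  also have "\<dots> = (transpose_mat ?C *\<^sub>v v) \<bullet> conjugate v" using v Ct by simp
  also have "\<dots> = v \<bullet> (?C *\<^sub>v conjugate v)"
    by (rule transpose_vec_mult_scalar[OF C]) (use v in auto)
  also have "\<dots> = v \<bullet> conjugate (e \<cdot>\<^sub>v v)" using conj v by simp
  also have "\<dots> = cnj e * (v \<bullet>c v)"
  proof -
    have "conjugate (e \<cdot>\<^sub>v v) = cnj e \<cdot>\<^sub>v conjugate v" by (rule eq_vecI) auto
    then show ?thesis using v by simp
  qed
  finally have "e * (v \<bullet>c v) = cnj e * (v \<bullet>c v)" .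
  moreover have "v \<bullet>c v \<noteq> 0" using v by (simp add: conjugate_square_eq_0_vec)
  ultimately have "e = cnj e" by simp
  then show ?thesis by (metis Im_complex_of_real complex_In_mult_cnj_zero complex_cnj_cancel_iff
      cnj.simps(2) neg_equal_zero)
qed

text \<open>An eigenvalue exists over the complex numbers; being real, it is a root of the real characteristic
polynomial, which provides a real eigenvector.\<close>

lemma symmetric_real_eigenvector:
  fixes M :: "real mat"
  assumes M: "M \<in> carrier_mat n n" and sym: "transpose_mat M = M" and n: "n > 0"
  obtains l and v :: "real vec" where "v \<in> carrier_vec n" "v \<bullet> v = 1" "M *\<^sub>v v = l \<cdot>\<^sub>v v"
proof -
  let ?C = "map_mat complex_of_real M"
  have C: "?C \<in> carrier_mat n n" using M by auto
  obtain e where e: "eigenvalue ?C e"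
    using spectrum_non_empty[OF C n] unfolding spectrum_def by auto
  from symmetric_complex_eigenvalue_real[OF M sym e] have eq: "e = complex_of_real (Re e)"
    by (simp add: complex_eq_iff)
  have "poly (map_poly complex_of_real (char_poly M)) (complex_of_real (Re e)) = 0"
    using e eq eigenvalue_root_char_poly[OF C] of_real_hom.char_poly_hom[OF M] by metis
  then have "poly (char_poly M) (Re e) = 0"
    by (simp add: of_real_hom.poly_map_poly)
  then have "eigenvalue M (Re e)" using eigenvalue_root_char_poly[OF M] by simp
  then obtain u where u: "u \<in> carrier_vec n" "u \<noteq> 0\<^sub>v n" "M *\<^sub>v u = Re e \<cdot>\<^sub>v u"
    unfolding eigenvalue_def eigenvector_def using M by auto
  have "conjugate u = u" by (rule eq_vecI) auto
  moreover have "u \<bullet>c u > 0" using u conjugate_square_greater_0_vec by blast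
  ultimately have pos: "u \<bullet> u > 0" by simp
  define c where "c = 1 / sqrt (u \<bullet> u)"
  show thesis
  proof (rule that[of "c \<cdot>\<^sub>v u" "Re e"])
    show "c \<cdot>\<^sub>v u \<in> carrier_vec n" using u by simp
    show "(c \<cdot>\<^sub>v u) \<bullet> (c \<cdot>\<^sub>v u) = 1"
      using u pos by (simp add: c_def real_sqrt_mult_self)
    show "M *\<^sub>v (c \<cdot>\<^sub>v u) = Re e \<cdot>\<^sub>v (c \<cdot>\<^sub>v u)"
      using u M by (simp add: mult_mat_vec smult_smult_assoc mult.commute)
  qed
qed

text \<open>The reflection in the hyperplane orthogonal to \<open>w = v - e\<^sub>0\<close> exchanges \<open>v\<close> and \<open>e\<^sub>0\<close>. It extends
\<open>v\<close> to an orthonormal basis by an explicit formula.\<close>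

lemma householder_reflection:
  fixes v :: "real vec"
  assumes v: "v \<in> carrier_vec (Suc n)" and unit: "v \<bullet> v = 1"
  obtains H where "H \<in> carrier_mat (Suc n) (Suc n)" "transpose_mat H = H"
    "H * H = 1\<^sub>m (Suc n)" "H *\<^sub>v unit_vec (Suc n) 0 = v"
proof -
  let ?N = "Suc n"
  define w where "w = v - unit_vec ?N 0"
  define s where "s = w \<bullet> w"
  \<comment> \<open>For \<open>v = e\<^sub>0\<close> this is \<open>2 / 0 = 0\<close>, and \<open>H\<close> is the identity, as it should be.\<close>
  define c where "c = 2 / s"
  define H where "H = mat ?N ?N (\<lambda>(i, j). (if i = j then 1 else 0) - c * (w $ i * w $ j))"
  have w: "w \<in> carrier_vec ?N" using v by (simp add: w_def)
  have wi: "w $ i = v $ i - (if i = 0 then 1 else 0)" if "i < ?N" for i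
    using that v by (simp add: w_def unit_vec_def)
  have ssum: "s = (\<Sum>k = 0..<?N. w $ k * w $ k)" using w by (simp add: s_def scalar_prod_def)
  have vsum: "(\<Sum>k = 0..<?N. v $ k * v $ k) = 1" using v unit by (simp add: scalar_prod_def)
  have s2: "s = 2 - 2 * v $ 0"
  proof -
    have "s = (\<Sum>k = 0..<?N. v $ k * v $ k + (if k = 0 then 1 - 2 * v $ 0 else 0))"
      unfolding ssum by (rule sum.cong) (auto simp: wi algebra_simps)
    also have "\<dots> = 1 + (1 - 2 * v $ 0)"
      unfolding sum.distrib vsum by simp
    finally show ?thesis by simp
  qed
  have ccs: "c * c * s = 2 * c" by (simp add: c_def)
  have H: "H \<in> carrier_mat ?N ?N" by (simp add: H_def)
  show thesis
  proof (rule that[of H])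
    show "H \<in> carrier_mat ?N ?N" by (rule H)
    show "transpose_mat H = H" by (rule eq_matI) (auto simp: H_def mult.commute)
    show "H * H = 1\<^sub>m ?N"
    proof (rule eq_matI)
      fix i j assume ij: "i < dim_row (1\<^sub>m ?N)" "j < dim_col (1\<^sub>m ?N :: real mat)"
      then have i: "i < ?N" and j: "j < ?N" by auto
      have "(H * H) $$ (i, j) = (\<Sum>k = 0..<?N. H $$ (i, k) * H $$ (k, j))"
        using H i j by (simp add: scalar_prod_def)
      also have "\<dots> = (\<Sum>k = 0..<?N. (if k = j then (if i = j then 1 else 0) - c * (w $ i * w $ j)
          else 0)
           - (if k = i then c * (w $ i * w $ j) else 0)
           + c * c * w $ i * w $ j * (w $ k * w $ k))"
        by (rule sum.cong) (auto simp: H_def i j algebra_simps)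
      also have "\<dots> = (if i = j then 1 else 0) - c * (w $ i * w $ j) - c * (w $ i * w $ j)
           + c * c * w $ i * w $ j * s"
        unfolding sum.distrib sum_subtractf sum_distrib_left[symmetric] ssum[symmetric]
        using i j by simp
      also have "c * c * w $ i * w $ j * s = 2 * c * (w $ i * w $ j)"
        using ccs by (metis mult.assoc mult.commute)
      finally show "(H * H) $$ (i, j) = 1\<^sub>m ?N $$ (i, j)" using i j by simp
    qed (use H in auto)
    show "H *\<^sub>v unit_vec ?N 0 = v"
    proof (rule eq_vecI)
      fix i assume "i < dim_vec v"
      then have i: "i < ?N" using v by auto
      have "(H *\<^sub>v unit_vec ?N 0) $ i = (if i = 0 then 1 else 0) - c * (w $ i * w $ 0)"
        using H i by (simp add: H_def)
      also have "c * (w $ i * w $ 0) = - w $ i"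
      proof (cases "s = 0")
        case True
        then have "w $ i * w $ i = 0"
          using i unfolding ssum by (subst (asm) sum_nonneg_eq_0_iff) auto
        then show ?thesis by simp
      next
        case False
        have "w $ 0 = - s / 2" using s2 wi[of 0] by simp
        then show ?thesis using False by (simp add: c_def)
      qed
      finally show "(H *\<^sub>v unit_vec ?N 0) $ i = v $ i" using wi[OF i] by simp
    qed (use H v in auto)
  qed
qed

text \<open>A reflection sending \<open>e\<^sub>0\<close> to a unit eigenvector conjugates the matrix to one that splits off a
\<open>1 \<times> 1\<close> block, and the induction hypothesis applies to the complementary block.\<close>

theorem real_symmetric_diagonalization:
  fixes M :: "real mat"
  assumes "M \<in> carrier_mat n n" "transpose_mat M = M"
  shows "\<exists>U d. U \<in> carrier_mat n n \<and> transpose_mat U * U = 1\<^sub>m n \<and>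
           M = U * mat_diag n d * transpose_mat U"
  using assms
proof (induction n arbitrary: M)
  case 0
  show ?case
    by (rule exI[of _ "1\<^sub>m 0"]) (use 0 in \<open>auto intro!: eq_matI\<close>)
next
  case (Suc n M)
  let ?N = "Suc n"
  note assoc[simp] = assoc_mult_mat[of _ ?N ?N _ ?N _ ?N]
  note M = Suc.prems(1) and Mt = Suc.prems(2)
  obtain l and v :: "real vec"
    where v: "v \<in> carrier_vec ?N" "v \<bullet> v = 1" "M *\<^sub>v v = l \<cdot>\<^sub>v v"
    using symmetric_real_eigenvector[OF M Mt zero_less_Suc] .
  obtain H where H: "H \<in> carrier_mat ?N ?N" and Ht: "transpose_mat H = H"
    and HH: "H * H = 1\<^sub>m ?N" and He: "H *\<^sub>v unit_vec ?N 0 = v"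
    using householder_reflection[OF v(1,2)] .
  let ?e = "unit_vec ?N 0 :: real vec"
  have Hv: "H *\<^sub>v v = ?e"
    using He HH H v by (metis assoc_mult_mat_vec one_mult_mat_vec unit_vec_carrier)
  define N where "N = H * M * H"
  have N: "N \<in> carrier_mat ?N ?N" using H M by (simp add: N_def)
  have Nt: "transpose_mat N = N"
    unfolding N_def using H M Ht Mt by (simp add: transpose_mult[of _ ?N ?N _ ?N])
  have Ne: "N *\<^sub>v ?e = l \<cdot>\<^sub>v ?e"
  proof -
    have "N *\<^sub>v ?e = H *\<^sub>v (M *\<^sub>v (H *\<^sub>v ?e))"
      unfolding N_def using H M by (simp add: assoc_mult_mat_vec[of _ ?N ?N _ ?N])
    also have "\<dots> = l \<cdot>\<^sub>v ?e" using He v Hv H by (simp add: mult_mat_vec[of _ ?N ?N])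
    finally show ?thesis .
  qed
  have N0: "N $$ (i, 0) = (if i = 0 then l else 0)" if "i < ?N" for i
  proof -
    have "N $$ (i, 0) = (N *\<^sub>v ?e) $ i" using N that by simp
    also have "\<dots> = (if i = 0 then l else 0)" unfolding Ne using that by (simp add: unit_vec_def)
    finally show ?thesis .
  qed
  have N0': "N $$ (0, i) = (if i = 0 then l else 0)" if "i < ?N" for i
    using N0[OF that] Nt N that by (metis carrier_matD index_transpose_mat(1) zero_less_Suc)
  define M3 where "M3 = mat n n (\<lambda>(i, j). N $$ (Suc i, Suc j))"
  have M3: "M3 \<in> carrier_mat n n" by (simp add: M3_def)
  have M3t: "transpose_mat M3 = M3"
    using N Nt by (intro eq_matI) (auto simp: M3_def, metis Nt N Suc_less_eq carrier_matD
        index_transpose_mat(1))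
  from Suc.IH[OF M3 M3t] obtain U3 d where U3: "U3 \<in> carrier_mat n n"
    and U3U: "transpose_mat U3 * U3 = 1\<^sub>m n" and M3d: "M3 = U3 * mat_diag n d * transpose_mat U3"
    by blast
  define V where "V = four_block_mat (1\<^sub>m 1) (0\<^sub>m 1 n) (0\<^sub>m n 1) U3"
  define D where "D = mat_diag ?N (case_nat l d)"
  have V: "V \<in> carrier_mat ?N ?N" using U3 by (auto simp: V_def)
  have D: "D \<in> carrier_mat ?N ?N" by (simp add: D_def)
  have Vt: "transpose_mat V = four_block_mat (1\<^sub>m 1) (0\<^sub>m 1 n) (0\<^sub>m n 1) (transpose_mat U3)"
    unfolding V_def using U3 by (subst transpose_four_block_mat) auto
  have D4: "D = four_block_mat (l \<cdot>\<^sub>m 1\<^sub>m 1) (0\<^sub>m 1 n) (0\<^sub>m n 1) (mat_diag n d)"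
    by (rule eq_matI) (auto simp: D_def mat_diag_def less_Suc_eq_0_disj split: nat.splits)
  have N4: "N = four_block_mat (l \<cdot>\<^sub>m 1\<^sub>m 1) (0\<^sub>m 1 n) (0\<^sub>m n 1) M3"
    by (rule eq_matI) (use N N0 N0' in \<open>auto simp: M3_def less_Suc_eq_0_disj\<close>)
  have VV: "transpose_mat V * V = 1\<^sub>m ?N"
    unfolding Vt unfolding V_def
    by (subst mult_four_block_mat[of _ 1 1 _ n _ n _ _ 1 _ n])
      (use U3 U3U in \<open>auto intro!: eq_matI\<close>)
  have ND: "N = V * D * transpose_mat V"
  proof -
    have VD: "V * D = four_block_mat (l \<cdot>\<^sub>m 1\<^sub>m 1) (0\<^sub>m 1 n) (0\<^sub>m n 1) (U3 * mat_diag n d)"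
      unfolding D4 V_def
      by (subst mult_four_block_mat[of _ 1 1 _ n _ n _ _ 1 _ n])
        (use U3 in \<open>auto simp: left_mult_zero_mat[OF mat_diag_dim]\<close>)
    have E: "U3 * mat_diag n d \<in> carrier_mat n n" "U3 * mat_diag n d * transpose_mat U3 \<in>
        carrier_mat n n"
      using U3 mult_carrier_mat[OF U3 mat_diag_dim] by auto
    show ?thesis
      unfolding VD N4 Vt M3d
      by (subst mult_four_block_mat[of _ 1 1 _ n _ n _ _ 1 _ n])
       (use U3 E in \<open>auto simp: right_mult_zero_mat[OF E(1)] left_add_zero_mat[OF E(2)]\<close>)
  qed
  define U where "U = H * V"
  have Ut: "transpose_mat U = transpose_mat V * H"
    unfolding U_def using H V Ht by (simp add: transpose_mult[of _ ?N ?N _ ?N])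
  have Vt': "transpose_mat V \<in> carrier_mat ?N ?N" using V by simp
  have "transpose_mat U * U = transpose_mat V * ((H * H) * V)"
    unfolding Ut using H V Vt' by (simp add: U_def)
  then have UU: "transpose_mat U * U = 1\<^sub>m ?N" using HH VV V by simp
  have "U * D * transpose_mat U = H * (V * D * transpose_mat V) * H"
    unfolding Ut using H V Vt' D by (simp add: U_def)
  also have "\<dots> = (H * H) * M * (H * H)"
    unfolding ND[symmetric] unfolding N_def using H M by simp
  also have "\<dots> = M" unfolding HH using M by simp
  finally have "M = U * mat_diag ?N (case_nat l d) * transpose_mat U" by (simp add: D_def)
  moreover have "U \<in> carrier_mat ?N ?N" using H V by (simp add: U_def)
  ultimately show ?case using UU by blast
qed

text \<open>The conjugates \<open>U D U\<^sup>T\<close> by a fixed orthogonal \<open>U\<close> multiply like the diagonal matrices \<open>D\<close>. This is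
the functional calculus by which inverse, square root and pseudoinverse are obtained from their
scalar counterparts.\<close>

lemma orthogonal_conj_mult:
  fixes U :: "real mat"
  assumes U: "U \<in> carrier_mat n n" and UU: "transpose_mat U * U = 1\<^sub>m n"
    and D: "D \<in> carrier_mat n n" "E \<in> carrier_mat n n"
  shows "(U * D * transpose_mat U) * (U * E * transpose_mat U) = U * (D * E) * transpose_mat U"
proof -
  note assoc[simp] = assoc_mult_mat[of _ n n _ n _ n]
  have Ut: "transpose_mat U \<in> carrier_mat n n" using U by simp
  have "(U * D * transpose_mat U) * (U * E * transpose_mat U)
    = U * D * (transpose_mat U * U) * (E * transpose_mat U)"
    using U Ut D by simp
  also have "\<dots> = U * (D * E) * transpose_mat U"
    unfolding UU using U Ut D by simp
  finally show ?thesis .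
qed

lemma orthogonal_conj_diag_mult:
  fixes U :: "real mat"
  assumes U: "U \<in> carrier_mat n n" and UU: "transpose_mat U * U = 1\<^sub>m n"
  shows "(U * mat_diag n f * transpose_mat U) * (U * mat_diag n g * transpose_mat U)
    = U * mat_diag n (\<lambda>i. f i * g i) * transpose_mat U"
  using orthogonal_conj_mult[OF U UU mat_diag_dim mat_diag_dim] by simp

lemma orthogonal_conj_diag_carrier:
  fixes U :: "real mat"
  assumes U: "U \<in> carrier_mat n n"
  shows "U * mat_diag n f * transpose_mat U \<in> carrier_mat n n"
  using mult_carrier_mat[OF mult_carrier_mat[OF U mat_diag_dim], of "transpose_mat U" n] U by simp

lemma orthogonal_conj_diag_transpose:
  fixes U :: "real mat"
  assumes U: "U \<in> carrier_mat n n"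
  shows "transpose_mat (U * mat_diag n f * transpose_mat U) = U * mat_diag n f * transpose_mat U"
proof -
  have "transpose_mat (mat_diag n f) = mat_diag n f"
    by (rule eq_matI) (auto simp: mat_diag_def)
  then show ?thesis
    using U mult_carrier_mat[OF U mat_diag_dim[of n f]] assoc_mult_mat[OF U mat_diag_dim[of n f],
        of "transpose_mat U" n]
      transpose_mult[OF U mat_diag_dim[of n f]] transpose_mult[of "U * mat_diag n f" n n
          "transpose_mat U" n]
    by simp
qed

lemma orthogonal_conj_diag_one:
  fixes U :: "real mat"
  assumes U: "U \<in> carrier_mat n n" and UU: "transpose_mat U * U = 1\<^sub>m n"
  shows "U * mat_diag n (\<lambda>_. 1) * transpose_mat U = 1\<^sub>m n"
  using U mat_mult_left_right_inverse[OF _ U UU] by simp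

lemma orthogonal_conj_diag_form:
  fixes U :: "real mat"
  assumes U: "U \<in> carrier_mat n n" and v: "v \<in> carrier_vec n"
  shows "ip_B (U * mat_diag n f * transpose_mat U) v v
    = (\<Sum>i<n. f i * ((transpose_mat U *\<^sub>v v) $ i)\<^sup>2)"
proof -
  have D: "mat_diag n f \<in> carrier_mat n n" by simp
  let ?c = "transpose_mat U *\<^sub>v v"
  have c: "?c \<in> carrier_vec n" using U v by simp
  have Dc: "mat_diag n f *\<^sub>v ?c = vec n (\<lambda>i. f i * ?c $ i)"
  proof (rule eq_vecI)
    fix i assume "i < dim_vec (vec n (\<lambda>i. f i * ?c $ i))"
    then have i: "i < n" by simp
    have "(mat_diag n f *\<^sub>v ?c) $ i = (\<Sum>j = 0..<n. (if i = j then f j else 0) * ?c $ j)"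
      using c i U by (simp add: mat_diag_def scalar_prod_def)
    also have "\<dots> = (\<Sum>j = 0..<n. if i = j then f j * ?c $ j else 0)"
      by (rule sum.cong) auto
    finally show "(mat_diag n f *\<^sub>v ?c) $ i = vec n (\<lambda>i. f i * ?c $ i) $ i" using i by simp
  qed (simp add: mat_diag_def)
  have "ip_B (U * mat_diag n f * transpose_mat U) v v = v \<bullet> (U *\<^sub>v (mat_diag n f *\<^sub>v ?c))"
    unfolding ip_B_def
    using assoc_mult_mat_vec[OF mult_carrier_mat[OF U D], of "transpose_mat U" n v]
      assoc_mult_mat_vec[OF U D c] U v by simp
  also have "\<dots> = ?c \<bullet> (mat_diag n f *\<^sub>v ?c)"
    by (rule transpose_vec_mult_scalar[OF U mult_mat_vec_carrier[OF D c] v, symmetric])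
  also have "\<dots> = (\<Sum>i<n. f i * (?c $ i)\<^sup>2)"
    unfolding Dc scalar_prod_def
    by (auto simp: atLeast0LessThan power2_eq_square intro!: sum.cong)
  finally show ?thesis .
qed

lemma orthogonal_norm_sum:
  fixes U :: "real mat"
  assumes U: "U \<in> carrier_mat n n" and UU: "transpose_mat U * U = 1\<^sub>m n" and v: "v \<in> carrier_vec n"
  shows "v \<bullet> v = (\<Sum>i<n. ((transpose_mat U *\<^sub>v v) $ i)\<^sup>2)"
  using orthogonal_conj_diag_form[OF U v, of "\<lambda>_. 1"] v
  unfolding orthogonal_conj_diag_one[OF U UU] by (simp add: ip_B_def)

lemma orthogonal_col:
  fixes U :: "real mat"
  assumes U: "U \<in> carrier_mat n n" and UU: "transpose_mat U * U = 1\<^sub>m n" and i: "i < n"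
  shows "transpose_mat U *\<^sub>v col U i = unit_vec n i" "col U i \<bullet> col U i = 1" "col U i \<noteq> 0\<^sub>v n"
    "(U * mat_diag n f * transpose_mat U) *\<^sub>v col U i = f i \<cdot>\<^sub>v col U i"
proof -
  have "col (transpose_mat U * U) i = transpose_mat U *\<^sub>v col U i"
    using U i by (intro col_mult2[of _ n n _ n]) auto
  then show 1: "transpose_mat U *\<^sub>v col U i = unit_vec n i" using UU i by simp
  have "(transpose_mat U * U) $$ (i, i) = col U i \<bullet> col U i" using U i by simp
  then show 2: "col U i \<bullet> col U i = 1" using UU i by simp
  show "col U i \<noteq> 0\<^sub>v n" using 2 by auto
  have D: "mat_diag n f \<in> carrier_mat n n" by simp
  have De: "mat_diag n f *\<^sub>v unit_vec n i = f i \<cdot>\<^sub>v unit_vec n i"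
    by (rule eq_vecI) (use i in \<open>auto simp: mat_diag_def\<close>)
  have "(U * mat_diag n f * transpose_mat U) *\<^sub>v col U i = U *\<^sub>v (mat_diag n f *\<^sub>v unit_vec n i)"
    using assoc_mult_mat_vec[OF mult_carrier_mat[OF U D], of "transpose_mat U" n "col U i"]
      assoc_mult_mat_vec[OF U D unit_vec_carrier] U i 1 by simp
  also have "\<dots> = f i \<cdot>\<^sub>v (U *\<^sub>v unit_vec n i)"
    unfolding De by (rule mult_mat_vec[OF U]) simp
  also have "U *\<^sub>v unit_vec n i = col U i" by (rule eq_vecI) (use U i in auto)
  finally show "(U * mat_diag n f * transpose_mat U) *\<^sub>v col U i = f i \<cdot>\<^sub>v col U i" .
qed

text \<open>If \<open>l\<close> differs from every \<open>d i\<close>, then symmetry makes an eigenvector for \<open>l\<close> orthogonal to all columns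
of \<open>U\<close>, hence zero.\<close>

lemma eigenvalue_orthogonal_conj_diag:
  fixes U :: "real mat"
  assumes U: "U \<in> carrier_mat n n" and UU: "transpose_mat U * U = 1\<^sub>m n"
  shows "eigenvalue (U * mat_diag n d * transpose_mat U) l \<longleftrightarrow> (\<exists>i<n. l = d i)"
    (is "eigenvalue ?M l \<longleftrightarrow> _")
proof
  have M: "?M \<in> carrier_mat n n" by (rule orthogonal_conj_diag_carrier[OF U])
  assume "\<exists>i<n. l = d i"
  then show "eigenvalue ?M l"
    unfolding eigenvalue_def eigenvector_def
    using orthogonal_col(3,4)[OF U UU] M U by (metis carrier_matD col_carrier_vec)
next
  have M: "?M \<in> carrier_mat n n" by (rule orthogonal_conj_diag_carrier[OF U])
  assume "eigenvalue ?M l"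
  then obtain v where v: "v \<in> carrier_vec n" "v \<noteq> 0\<^sub>v n" "?M *\<^sub>v v = l \<cdot>\<^sub>v v"
    unfolding eigenvalue_def eigenvector_def using M by auto
  show "\<exists>i<n. l = d i"
  proof (rule ccontr)
    assume no: "\<not> ?thesis"
    have "col U i \<bullet> v = 0" if i: "i < n" for i
    proof -
      have "d i * (col U i \<bullet> v) = (transpose_mat ?M *\<^sub>v col U i) \<bullet> v"
        using orthogonal_col(4)[OF U UU i, of d] orthogonal_conj_diag_transpose[OF U] U v i
        by simp
      also have "\<dots> = col U i \<bullet> (?M *\<^sub>v v)"
        by (rule transpose_vec_mult_scalar[OF M]) (use U i v in auto)
      also have "\<dots> = l * (col U i \<bullet> v)" using v U i by simp
      finally show ?thesis using no i by auto
    qed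
    then have "v \<bullet> v = 0"
      unfolding orthogonal_norm_sum[OF U UU v(1)] using U v by (auto intro!: sum.neutral)
    moreover have "conjugate v = v" by (rule eq_vecI) auto
    ultimately have "v \<bullet>c v = 0" by simp
    then show False using v conjugate_square_eq_0_vec by blast
  qed
qed

section \<open>Bilinear forms of matrices\<close>

lemma scalar_prod_self_pos:
  fixes v :: "real vec"
  assumes "v \<in> carrier_vec n" "v \<noteq> 0\<^sub>v n"
  shows "v \<bullet> v > 0"
proof -
  have "conjugate v = v" by (rule eq_vecI) auto
  then show ?thesis using conjugate_square_greater_0_vec[OF assms(1)] assms(2) by simp
qed

lemma ip_B_add_left:
  assumes "M \<in> carrier_mat n n" "x \<in> carrier_vec n" "y \<in> carrier_vec n" "z \<in> carrier_vec n"
  shows "ip_B M (x + y) z = ip_B M x z + ip_B M y z"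
  using assms by (simp add: ip_B_def add_scalar_prod_distrib[of _ n])

lemma ip_B_add_right:
  assumes "M \<in> carrier_mat n n" "x \<in> carrier_vec n" "y \<in> carrier_vec n" "z \<in> carrier_vec n"
  shows "ip_B M z (x + y) = ip_B M z x + ip_B M z y"
  using assms by (simp add: ip_B_def mult_add_distrib_mat_vec[of _ n n] scalar_prod_add_distrib[of
      _ n])

lemma ip_B_minus_left:
  assumes "M \<in> carrier_mat n n" "x \<in> carrier_vec n" "y \<in> carrier_vec n" "z \<in> carrier_vec n"
  shows "ip_B M (x - y) z = ip_B M x z - ip_B M y z"
  using assms by (simp add: ip_B_def minus_scalar_prod_distrib[of _ n])

lemma ip_B_minus_right:
  assumes "M \<in> carrier_mat n n" "x \<in> carrier_vec n" "y \<in> carrier_vec n" "z \<in> carrier_vec n"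
  shows "ip_B M z (x - y) = ip_B M z x - ip_B M z y"
  using assms by (simp add: ip_B_def mult_minus_distrib_mat_vec[of _ n n]
      scalar_prod_minus_distrib[of _ n])

lemma ip_B_smult_left:
  assumes "M \<in> carrier_mat n n" "x \<in> carrier_vec n" "z \<in> carrier_vec n"
  shows "ip_B M (c \<cdot>\<^sub>v x) z = c * ip_B M x z"
  using assms by (simp add: ip_B_def)

lemma ip_B_smult_right:
  assumes "M \<in> carrier_mat n n" "x \<in> carrier_vec n" "z \<in> carrier_vec n"
  shows "ip_B M z (c \<cdot>\<^sub>v x) = c * ip_B M z x"
  using assms by (simp add: ip_B_def mult_mat_vec[of _ n n])

lemmas ip_B_bilinear = ip_B_add_left ip_B_add_right ip_B_minus_left ip_B_minus_right
  ip_B_smult_left ip_B_smult_right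

lemma ip_B_sym:
  assumes "M \<in> carrier_mat n n" "transpose_mat M = M" "x \<in> carrier_vec n" "y \<in> carrier_vec n"
  shows "ip_B M x y = ip_B M y x"
proof -
  have "ip_B M x y = (transpose_mat M *\<^sub>v x) \<bullet> y"
    unfolding ip_B_def using assms by (subst transpose_vec_mult_scalar[of _ n n]) auto
  also have "\<dots> = ip_B M y x"
    unfolding ip_B_def assms(2) using assms by (intro comm_scalar_prod[of _ n]) auto
  finally show ?thesis .
qed

lemma ip_B_entries:
  assumes "M \<in> carrier_mat n n" "x \<in> carrier_vec n" "y \<in> carrier_vec n"
  shows "ip_B M x y = (\<Sum>i<n. \<Sum>j<n. M $$ (i, j) * (x $ i * y $ j))"
  using assms by (auto simp: ip_B_def scalar_prod_def atLeast0LessThan sum_distrib_left ac_simps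
      intro!: sum.cong)

lemma spd_ip_nonneg:
  assumes "spd_mat n B" "x \<in> carrier_vec n"
  shows "ip_B B x x \<ge> 0"
  using assms by (cases "x = 0\<^sub>v n") (auto simp: spd_mat_def ip_B_def intro: less_imp_le)

lemma spd_ip_zero_iff:
  assumes "spd_mat n B" "x \<in> carrier_vec n"
  shows "ip_B B x x = 0 \<longleftrightarrow> x = 0\<^sub>v n"
  using assms by (cases "x = 0\<^sub>v n") (auto simp: spd_mat_def ip_B_def dest: bspec)

lemma norm_B_square:
  assumes "spd_mat n B" "x \<in> carrier_vec n"
  shows "(norm_B B x)\<^sup>2 = ip_B B x x"
  using spd_ip_nonneg[OF assms] by (simp add: norm_B_def)

section \<open>Inverse and square root of a positive definite matrix\<close>

lemma spd_diagonalization: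
  assumes B: "spd_mat n B"
  obtains U d where "U \<in> carrier_mat n n" "transpose_mat U * U = 1\<^sub>m n"
    "B = U * mat_diag n d * transpose_mat U" "\<And>i. i < n \<Longrightarrow> d i > 0"
proof -
  have Bc: "B \<in> carrier_mat n n" and Bt: "transpose_mat B = B" using B by (auto simp: spd_mat_def)
  obtain U d where U: "U \<in> carrier_mat n n" and UU: "transpose_mat U * U = 1\<^sub>m n"
    and Bd: "B = U * mat_diag n d * transpose_mat U"
    using real_symmetric_diagonalization[OF Bc Bt] by blast
  have "d i > 0" if i: "i < n" for i
  proof -
    have "col U i \<bullet> (B *\<^sub>v col U i) > 0"
      using B orthogonal_col(3)[OF U UU i] U i by (auto simp: spd_mat_def)
    also have "col U i \<bullet> (B *\<^sub>v col U i) = d i"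
      unfolding Bd orthogonal_col(4)[OF U UU i] using orthogonal_col(2)[OF U UU i] U i by simp
    finally show ?thesis .
  qed
  then show thesis using that U UU Bd by blast
qed

lemma orthogonal_conj_diag_spd:
  fixes U :: "real mat"
  assumes U: "U \<in> carrier_mat n n" and UU: "transpose_mat U * U = 1\<^sub>m n"
    and d: "\<And>i. i < n \<Longrightarrow> d i > 0"
  shows "spd_mat n (U * mat_diag n d * transpose_mat U)"
proof -
  have "v \<bullet> ((U * mat_diag n d * transpose_mat U) *\<^sub>v v) > 0"
    if v: "v \<in> carrier_vec n" "v \<noteq> 0\<^sub>v n" for v
  proof -
    let ?c = "transpose_mat U *\<^sub>v v"
    have "(\<Sum>i<n. (?c $ i)\<^sup>2) > 0"
      using scalar_prod_self_pos[OF v] orthogonal_norm_sum[OF U UU v(1)] by simp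
    then obtain i where i: "i < n" "(?c $ i)\<^sup>2 > 0"
      by (metis (no_types, lifting) lessThan_iff not_less sum_nonpos)
    have "0 < d i * (?c $ i)\<^sup>2" using d i by simp
    also have "\<dots> \<le> (\<Sum>i<n. d i * (?c $ i)\<^sup>2)"
      by (rule member_le_sum) (use d i in \<open>auto intro!: mult_nonneg_nonneg less_imp_le[OF d]\<close>)
    finally show ?thesis using orthogonal_conj_diag_form[OF U v(1), of d] by (simp add: ip_B_def)
  qed
  then show ?thesis
    unfolding spd_mat_def
    using orthogonal_conj_diag_transpose[OF U] orthogonal_conj_diag_carrier[OF U] by blast
qed

lemma spd_mat_inv:
  assumes B: "spd_mat n B"
  shows "spd_mat n (mat_inv B)" "B * mat_inv B = 1\<^sub>m n" "mat_inv B * B = 1\<^sub>m n"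
proof -
  have Bc: "B \<in> carrier_mat n n" using B by (auto simp: spd_mat_def)
  obtain U d where U: "U \<in> carrier_mat n n" and UU: "transpose_mat U * U = 1\<^sub>m n"
    and Bd: "B = U * mat_diag n d * transpose_mat U" and d: "\<And>i. i < n \<Longrightarrow> d i > 0"
    using spd_diagonalization[OF B] by blast
  define C where "C = U * mat_diag n (\<lambda>i. 1 / d i) * transpose_mat U"
  have C: "spd_mat n C" unfolding C_def by (rule orthogonal_conj_diag_spd[OF U UU]) (use d in auto)
  have Cc: "C \<in> carrier_mat n n" using C by (auto simp: spd_mat_def)
  have "mat_diag n (\<lambda>i. d i * (1 / d i)) = mat_diag n (\<lambda>_. 1)"
    by (rule eq_matI) (auto simp: mat_diag_def dest: d)
  then have BC: "B * C = 1\<^sub>m n"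
    unfolding Bd C_def orthogonal_conj_diag_mult[OF U UU]
    using orthogonal_conj_diag_one[OF U UU] by metis
  have CB: "C * B = 1\<^sub>m n" using mat_mult_left_right_inverse[OF Bc Cc BC] .
  have "B \<in> Units (ring_mat TYPE(real) n ())"
    unfolding Units_def ring_mat_def using Bc Cc BC CB by auto
  then obtain X where X: "mat_inverse B = Some X"
    using mat_inverse(1)[OF Bc, of "()"] by (cases "mat_inverse B") auto
  from mat_inverse(2)[OF Bc X] have BX: "B * X = 1\<^sub>m n" "X * B = 1\<^sub>m n" "X \<in> carrier_mat n n" by auto
  have "X = C * (B * X)" using CB BX Bc Cc by (metis assoc_mult_mat left_mult_one_mat)
  then have "X = C" using BX Cc by simp
  then show "spd_mat n (mat_inv B)" "B * mat_inv B = 1\<^sub>m n" "mat_inv B * B = 1\<^sub>m n"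
    using X C BX by auto
qed

text \<open>If \<open>u\<close> is an eigenvector of \<open>R - Q\<close> with eigenvalue \<open>d\<close>, then
\<open>0 = |R u|\<^sup>2 - |Q u|\<^sup>2 = d (u\<^sup>T R u + u\<^sup>T Q u)\<close>, and the bracket is positive. So all eigenvalues of the
symmetric matrix \<open>R - Q\<close> vanish.\<close>

lemma spd_sqrt_unique:
  assumes R: "spd_mat n R" and Q: "spd_mat n Q" and eq: "R * R = Q * Q"
  shows "R = Q"
proof -
  have Rc: "R \<in> carrier_mat n n" "transpose_mat R = R" and Qc: "Q \<in> carrier_mat n n"
      "transpose_mat Q = Q"
    using R Q by (auto simp: spd_mat_def)
  let ?D = "R - Q"
  have Dc: "?D \<in> carrier_mat n n" using Qc by (simp add: minus_carrier_mat)
  have Dt: "transpose_mat ?D = ?D"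
    using transpose_minus[of R n n Q] Rc Qc by simp
  obtain U d where U: "U \<in> carrier_mat n n" and UU: "transpose_mat U * U = 1\<^sub>m n"
    and Dd: "?D = U * mat_diag n d * transpose_mat U"
    using real_symmetric_diagonalization[OF Dc Dt] by blast
  have "d i = 0" if i: "i < n" for i
  proof -
    let ?u = "col U i"
    have u: "?u \<in> carrier_vec n" "?u \<noteq> 0\<^sub>v n" using U i orthogonal_col(3)[OF U UU i] by auto
    have Du: "?D *\<^sub>v ?u = d i \<cdot>\<^sub>v ?u" unfolding Dd by (rule orthogonal_col(4)[OF U UU i])
    have "R *\<^sub>v ?u - Q *\<^sub>v ?u = d i \<cdot>\<^sub>v ?u"
      using Du minus_mult_distrib_mat_vec[OF Rc(1) Qc(1) u(1)] by simp
    then have Ru: "R *\<^sub>v ?u = Q *\<^sub>v ?u + d i \<cdot>\<^sub>v ?u"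
      using Rc(1) Qc(1) by (intro eq_vecI) (auto simp: vec_eq_iff)
    have RR: "R *\<^sub>v (R *\<^sub>v ?u) = (R * R) *\<^sub>v ?u" "Q *\<^sub>v (Q *\<^sub>v ?u) = (Q * Q) *\<^sub>v ?u"
      using Rc Qc u by (simp_all add: assoc_mult_mat_vec[of _ n n _ n])
    have "?u \<bullet> (R *\<^sub>v (R *\<^sub>v ?u)) = ?u \<bullet> (Q *\<^sub>v (Q *\<^sub>v ?u))"
      unfolding RR eq ..
    moreover have "?u \<bullet> (R *\<^sub>v (R *\<^sub>v ?u)) = (R *\<^sub>v ?u) \<bullet> (R *\<^sub>v ?u)"
      using transpose_vec_mult_scalar[OF Rc(1), of "R *\<^sub>v ?u" ?u] Rc u by simp
    moreover have "?u \<bullet> (Q *\<^sub>v (Q *\<^sub>v ?u)) = (Q *\<^sub>v ?u) \<bullet> (Q *\<^sub>v ?u)"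
      using transpose_vec_mult_scalar[OF Qc(1), of "Q *\<^sub>v ?u" ?u] Qc u by simp
    moreover have "(R *\<^sub>v ?u) \<bullet> (R *\<^sub>v ?u) - (Q *\<^sub>v ?u) \<bullet> (Q *\<^sub>v ?u)
       = d i * (?u \<bullet> (R *\<^sub>v ?u) + ?u \<bullet> (Q *\<^sub>v ?u))"
    proof -
      let ?q = "Q *\<^sub>v ?u"
      have q: "?q \<in> carrier_vec n" using Qc u by simp
      show ?thesis unfolding Ru using q u comm_scalar_prod[OF q u(1)]
        by (simp add: add_scalar_prod_distrib[of _ n] scalar_prod_add_distrib[of _ n] algebra_simps)
    qed
    ultimately have "d i * (?u \<bullet> (R *\<^sub>v ?u) + ?u \<bullet> (Q *\<^sub>v ?u)) = 0" by simp
    moreover have "?u \<bullet> (R *\<^sub>v ?u) > 0" "?u \<bullet> (Q *\<^sub>v ?u) > 0" using R Q u by (auto simp: spd_mat_def)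
    ultimately show ?thesis by simp
  qed
  then have "mat_diag n d = 0\<^sub>m n n" by (intro eq_matI) (auto simp: mat_diag_def)
  then have "?D = 0\<^sub>m n n" unfolding Dd using U by simp
  then show "R = Q"
    using Rc Qc by (intro eq_matI) (auto, metis carrier_matD eq_iff_diff_eq_0 index_minus_mat(1)
        index_zero_mat(1))
qed

lemma spd_sqrt:
  assumes B: "spd_mat n B"
  shows "spd_mat n (spd_sqrt n B)" "spd_sqrt n B * spd_sqrt n B = B"
proof -
  obtain U d where U: "U \<in> carrier_mat n n" and UU: "transpose_mat U * U = 1\<^sub>m n"
    and Bd: "B = U * mat_diag n d * transpose_mat U" and d: "\<And>i. i < n \<Longrightarrow> d i > 0"
    using spd_diagonalization[OF B] by blast
  define R where "R = U * mat_diag n (\<lambda>i. sqrt (d i)) * transpose_mat U"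
  have R: "spd_mat n R" unfolding R_def by (rule orthogonal_conj_diag_spd[OF U UU]) (use d in auto)
  have "mat_diag n (\<lambda>i. sqrt (d i) * sqrt (d i)) = mat_diag n d"
    by (rule eq_matI) (auto simp: mat_diag_def dest: d)
  then have RR: "R * R = B"
    unfolding R_def Bd orthogonal_conj_diag_mult[OF U UU] by simp
  have "\<exists>!R. spd_mat n R \<and> R * R = B" using R RR spd_sqrt_unique by blast
  from theI'[OF this] show "spd_mat n (spd_sqrt n B)" "spd_sqrt n B * spd_sqrt n B = B"
    unfolding spd_sqrt_def by auto
qed

section \<open>The pseudoinverse of a symmetric matrix\<close>

lemma is_pinv_unique:
  assumes X: "is_pinv M X" and Y: "is_pinv M Y"
  shows "X = Y"
proof -
  obtain r c where M: "M \<in> carrier_mat r c" by auto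
  have X': "X \<in> carrier_mat c r" "M * X * M = M" "X * M * X = X"
      "transpose_mat (M * X) = M * X" "transpose_mat (X * M) = X * M"
    and Y': "Y \<in> carrier_mat c r" "M * Y * M = M" "Y * M * Y = Y"
      "transpose_mat (M * Y) = M * Y" "transpose_mat (Y * M) = Y * M"
    using X Y M by (auto simp: is_pinv_def)
  have "M * X = (M * Y) * (M * X)"
    using assoc_mult_mat[of "M * Y" r r M c X r] M X' Y' by simp
  also have "\<dots> = transpose_mat ((M * X) * (M * Y))"
    using transpose_mult[of "M * X" r r "M * Y" r] M X' Y' by simp
  also have "(M * X) * (M * Y) = M * Y"
    using assoc_mult_mat[of "M * X" r r M c Y r] M X' Y' by simp
  finally have MX: "M * X = M * Y" using Y' by simp
  have "X * M = (X * M) * (Y * M)"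
    using assoc_mult_mat[of X c r M c "Y * M" c] assoc_mult_mat[of M r c Y r M c] M X' Y' by simp
  also have "\<dots> = transpose_mat ((Y * M) * (X * M))"
    using transpose_mult[of "Y * M" c c "X * M" c] M X' Y' by simp
  also have "(Y * M) * (X * M) = Y * M"
    using assoc_mult_mat[of Y c r M c "X * M" c] assoc_mult_mat[of M r c X r M c] M X' Y' by simp
  finally have XM: "X * M = Y * M" using Y' by simp
  have "X = X * (M * X)" using assoc_mult_mat[of X c r M c X r] M X' by simp
  also have "\<dots> = Y * M * Y"
    unfolding MX using assoc_mult_mat[of X c r M c Y r] M X' Y' XM by simp
  finally show ?thesis using Y' by simp
qed

text \<open>Invert the nonzero eigenvalues; the convention \<open>inverse 0 = 0\<close> does what is wanted on the kernel.\<close>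

lemma pinv_symmetric:
  assumes M: "M \<in> carrier_mat n n" and Mt: "transpose_mat M = M"
  shows "is_pinv M (pinv M)" "transpose_mat (pinv M) = pinv M" "pinv M \<in> carrier_mat n n"
    "M * pinv M = pinv M * M"
proof -
  obtain U d where U: "U \<in> carrier_mat n n" and UU: "transpose_mat U * U = 1\<^sub>m n"
    and Md: "M = U * mat_diag n d * transpose_mat U"
    using real_symmetric_diagonalization[OF M Mt] by blast
  define X where "X = U * mat_diag n (\<lambda>i. inverse (d i)) * transpose_mat U"
  have Xc: "X \<in> carrier_mat n n" unfolding X_def by (rule orthogonal_conj_diag_carrier[OF U])
  have diag: "mat_diag n f = mat_diag n g" if "\<And>i. f i = g i" for f g :: "nat \<Rightarrow> real"
    using that by presburger
  have MXM: "M * X * M = M" unfolding X_def Md orthogonal_conj_diag_mult[OF U UU]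
    by (rule arg_cong[where f = "\<lambda>D. U * D * transpose_mat U"], rule diag) (simp add: field_simps)
  have XMX: "X * M * X = X" unfolding X_def Md orthogonal_conj_diag_mult[OF U UU]
    by (rule arg_cong[where f = "\<lambda>D. U * D * transpose_mat U"], rule diag) (simp add: field_simps)
  have sy: "transpose_mat (M * X) = M * X" "transpose_mat (X * M) = X * M" "transpose_mat X = X"
    "M * X = X * M"
    unfolding X_def Md orthogonal_conj_diag_mult[OF U UU] orthogonal_conj_diag_transpose[OF U]
    by (auto simp: mult.commute)
  have pX: "is_pinv M X" unfolding is_pinv_def using M Xc MXM XMX sy by auto
  have "pinv M = X" unfolding pinv_def using pX is_pinv_unique by blast
  then show "is_pinv M (pinv M)" "transpose_mat (pinv M) = pinv M" "pinv M \<in> carrier_mat n n"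
    "M * pinv M = pinv M * M"
    using pX sy Xc by auto
qed

section \<open>Projection onto a weighted row space\<close>

text \<open>The product laws with side conditions on dimensions rather than on carriers, so that rewriting has no
intermediate dimension to guess.\<close>

lemma assoc_mult_mat_dim:
  "dim_col A = dim_row B \<Longrightarrow> dim_col B = dim_row C \<Longrightarrow> (A * B) * C = A * (B * C)"
  by (rule assoc_mult_mat[of A "dim_row A" "dim_col A" B "dim_col B" C "dim_col C"]) auto

lemma assoc_mult_mat_vec_dim:
  "dim_col A = dim_row B \<Longrightarrow> dim_col B = dim_vec v \<Longrightarrow> (A * B) *\<^sub>v v = A *\<^sub>v (B *\<^sub>v v)"
  by (rule assoc_mult_mat_vec[of A "dim_row A" "dim_col A" B "dim_col B" v]) auto

lemma transpose_mult_dim: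
  fixes A B :: "'a :: comm_semiring_0 mat"
  shows "dim_col A = dim_row B \<Longrightarrow> transpose_mat (A * B) = transpose_mat B * transpose_mat A"
  by (rule transpose_mult[of A "dim_row A" "dim_col A" B "dim_col B"]) auto

lemma transpose_adjoint_dim:
  fixes A :: "real mat"
  assumes "dim_vec x = dim_row A" "dim_vec y = dim_col A"
  shows "x \<bullet> (A *\<^sub>v y) = (transpose_mat A *\<^sub>v x) \<bullet> y"
  using assms by (intro transpose_vec_mult_scalar[of A "dim_row A" "dim_col A", symmetric]) (auto
      intro: carrier_vecI)

text \<open>Here \<open>G\<close> stands for a sketched matrix \<open>S\<^sup>T A\<close>, or for \<open>A\<close> itself when projecting onto the solution set.
The matrix \<open>B\<inverse> Z\<close> is the projection, orthogonal with respect to \<open>B\<close>, onto the range of \<open>B\<inverse> G\<^sup>T\<close>.\<close>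

locale weighted_row_projection =
  fixes n q :: nat and B G :: "real mat"
  assumes spd: "spd_mat n B" and G: "G \<in> carrier_mat q n"
begin

abbreviation Bi where "Bi \<equiv> mat_inv B"
definition gram_pinv where "gram_pinv = pinv (G * Bi * transpose_mat G)"
definition Z where "Z = transpose_mat G * gram_pinv * G"

lemma B: "B \<in> carrier_mat n n" "transpose_mat B = B"
  and Bi: "Bi \<in> carrier_mat n n" "transpose_mat Bi = Bi"
  using spd spd_mat_inv(1)[OF spd] by (auto simp: spd_mat_def)

lemma B_Bi_vec: "v \<in> carrier_vec n \<Longrightarrow> B *\<^sub>v (Bi *\<^sub>v v) = v" "v \<in> carrier_vec n \<Longrightarrow> Bi *\<^sub>v (B *\<^sub>v v) = v"
  using spd_mat_inv(2,3)[OF spd] B Bi by (metis assoc_mult_mat_vec one_mult_mat_vec)+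

lemma gram: "G * Bi * transpose_mat G \<in> carrier_mat q q"
  "transpose_mat (G * Bi * transpose_mat G) = G * Bi * transpose_mat G"
  using G Bi by (auto simp: transpose_mult_dim assoc_mult_mat_dim)

lemma gram_pinv: "gram_pinv \<in> carrier_mat q q" "transpose_mat gram_pinv = gram_pinv"
  using pinv_symmetric[OF gram] by (auto simp: gram_pinv_def)

lemma Z: "Z \<in> carrier_mat n n" "transpose_mat Z = Z"
  using G gram_pinv by (auto simp: Z_def transpose_mult_dim assoc_mult_mat_dim)

lemma Z_vec: "v \<in> carrier_vec n \<Longrightarrow> Z *\<^sub>v v = transpose_mat G *\<^sub>v (gram_pinv *\<^sub>v (G *\<^sub>v v))"
  using G gram_pinv by (simp add: Z_def assoc_mult_mat_vec_dim)

text \<open>The Penrose equations applied to vectors: in nested applications the products need no reassociation.\<close>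

lemma pinv_eqs_vec:
  assumes w: "w \<in> carrier_vec q"
  shows "gram_pinv *\<^sub>v (G *\<^sub>v (Bi *\<^sub>v (transpose_mat G *\<^sub>v (gram_pinv *\<^sub>v w)))) = gram_pinv *\<^sub>v w" (is ?a)
    and "G *\<^sub>v (Bi *\<^sub>v (transpose_mat G *\<^sub>v (gram_pinv *\<^sub>v (G *\<^sub>v (Bi *\<^sub>v (transpose_mat G *\<^sub>v w))))))
       = G *\<^sub>v (Bi *\<^sub>v (transpose_mat G *\<^sub>v w))" (is ?b)
    and "G *\<^sub>v (Bi *\<^sub>v (transpose_mat G *\<^sub>v (gram_pinv *\<^sub>v w)))
       = gram_pinv *\<^sub>v (G *\<^sub>v (Bi *\<^sub>v (transpose_mat G *\<^sub>v w)))" (is ?c)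
proof -
  let ?M = "G * Bi * transpose_mat G"
  have M: "?M *\<^sub>v u = G *\<^sub>v (Bi *\<^sub>v (transpose_mat G *\<^sub>v u))" if "u \<in> carrier_vec q" for u
    using that G Bi by (simp add: assoc_mult_mat_vec_dim)
  have X1: "?M * gram_pinv * ?M = ?M" "gram_pinv * ?M * gram_pinv = gram_pinv" "?M * gram_pinv =
      gram_pinv * ?M"
    using pinv_symmetric(1,4)[OF gram] unfolding is_pinv_def gram_pinv_def by auto
  have Xw: "gram_pinv *\<^sub>v w \<in> carrier_vec q" using gram_pinv w by simp
  have Mw: "?M *\<^sub>v w \<in> carrier_vec q" using gram w by simp
  have "gram_pinv *\<^sub>v (?M *\<^sub>v (gram_pinv *\<^sub>v w)) = (gram_pinv * ?M * gram_pinv) *\<^sub>v w"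
    using gram(1) gram_pinv w assoc_mult_mat_vec[of "gram_pinv * ?M" q q gram_pinv q w]
        assoc_mult_mat_vec[of gram_pinv q q ?M q "gram_pinv *\<^sub>v w"] by simp
  then show ?a unfolding X1(2) M[OF Xw] .
  have "?M *\<^sub>v (gram_pinv *\<^sub>v (?M *\<^sub>v w)) = (?M * gram_pinv * ?M) *\<^sub>v w"
    using gram(1) gram_pinv w assoc_mult_mat_vec[of "?M * gram_pinv" q q ?M q w]
        assoc_mult_mat_vec[of ?M q q gram_pinv q "?M *\<^sub>v w"] by simp
  then show ?b unfolding X1(1) using M w gram_pinv Mw by simp
  have "?M *\<^sub>v (gram_pinv *\<^sub>v w) = (?M * gram_pinv) *\<^sub>v w"
    using gram(1) gram_pinv w assoc_mult_mat_vec[of ?M q q gram_pinv q w] by simp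
  also have "\<dots> = gram_pinv *\<^sub>v (?M *\<^sub>v w)"
    unfolding X1(3) using gram(1) gram_pinv w assoc_mult_mat_vec[of gram_pinv q q ?M q w] by simp
  finally show ?c unfolding M[OF w] M[OF Xw] .
qed

lemma Z_Bi_Z: "v \<in> carrier_vec n \<Longrightarrow> Z *\<^sub>v (Bi *\<^sub>v (Z *\<^sub>v v)) = Z *\<^sub>v v"
  using G gram_pinv Bi pinv_eqs_vec(1)[of "G *\<^sub>v v"] by (simp add: Z_vec)

text \<open>With \<open>M = G B\<inverse> G\<^sup>T\<close> the difference of the two sides is \<open>p = G\<^sup>T r\<close>, where \<open>M r = 0\<close> by a Penrose
equation. Hence \<open>p\<^sup>T B\<inverse> p = r\<^sup>T M r = 0\<close>, and \<open>p = 0\<close> as \<open>B\<inverse>\<close> is positive definite.\<close>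

lemma Z_Bi_Gt:
  assumes y: "y \<in> carrier_vec q"
  shows "Z *\<^sub>v (Bi *\<^sub>v (transpose_mat G *\<^sub>v y)) = transpose_mat G *\<^sub>v y"
proof -
  define My where "My = G *\<^sub>v (Bi *\<^sub>v (transpose_mat G *\<^sub>v y))"
  define r where "r = y - gram_pinv *\<^sub>v My"
  define p where "p = transpose_mat G *\<^sub>v r"
  have My: "My \<in> carrier_vec q" using G Bi y by (simp add: My_def)
  have r: "r \<in> carrier_vec q" using My gram_pinv y by (simp add: r_def)
  have p: "p \<in> carrier_vec n" using G r by (simp add: p_def)
  have XMy: "gram_pinv *\<^sub>v My \<in> carrier_vec q" using gram_pinv My by simp
  have p': "p = transpose_mat G *\<^sub>v y - transpose_mat G *\<^sub>v (gram_pinv *\<^sub>v My)"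
    unfolding p_def r_def using G by (intro mult_minus_distrib_mat_vec[OF _ y XMy]) auto
  have a: "transpose_mat G *\<^sub>v y \<in> carrier_vec n" "transpose_mat G *\<^sub>v (gram_pinv *\<^sub>v My) \<in>
      carrier_vec n"
    using G y XMy by auto
  have "G *\<^sub>v (Bi *\<^sub>v p) = G *\<^sub>v (Bi *\<^sub>v (transpose_mat G *\<^sub>v y)) - G *\<^sub>v (Bi *\<^sub>v (transpose_mat G *\<^sub>v
      (gram_pinv *\<^sub>v My)))"
    unfolding p' mult_minus_distrib_mat_vec[OF Bi(1) a]
    using Bi a by (intro mult_minus_distrib_mat_vec[OF G]) auto
  also have "\<dots> = 0\<^sub>v q"
    using pinv_eqs_vec(2)[OF y] My by (simp add: My_def)
  finally have "G *\<^sub>v (Bi *\<^sub>v p) = 0\<^sub>v q" .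
  then have "p \<bullet> (Bi *\<^sub>v p) = 0"
    unfolding p_def using transpose_vec_mult_scalar[OF G, of "Bi *\<^sub>v p" r] Bi p r by (simp add:
        p_def)
  then have "p = 0\<^sub>v n" using spd_ip_zero_iff[OF spd_mat_inv(1)[OF spd] p] by (simp add: ip_B_def)
  then have "transpose_mat G *\<^sub>v y = transpose_mat G *\<^sub>v (gram_pinv *\<^sub>v My)"
    using p' a by (intro eq_vecI) (auto simp: vec_eq_iff)
  then show ?thesis using Z_vec[of "Bi *\<^sub>v (transpose_mat G *\<^sub>v y)"] Bi a by (simp add: My_def)
qed

lemma G_Bi_Z:
  assumes v: "v \<in> carrier_vec n"
  shows "G *\<^sub>v (Bi *\<^sub>v (Z *\<^sub>v v)) = G *\<^sub>v v"
proof -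
  have Gt: "transpose_mat G \<in> carrier_mat n q" using G by simp
  have 1: "Z * Bi * transpose_mat G = transpose_mat G"
  proof (rule eq_matI)
    fix i j assume "i < dim_row (transpose_mat G)" "j < dim_col (transpose_mat G)"
    then have ij: "i < n" "j < q" using G by auto
    have "(Z * Bi * transpose_mat G) *\<^sub>v unit_vec q j = transpose_mat G *\<^sub>v unit_vec q j"
      using Z_Bi_Gt[of "unit_vec q j"] G Z Bi by (simp add: assoc_mult_mat_vec_dim)
    then have "((Z * Bi * transpose_mat G) *\<^sub>v unit_vec q j) $ i = (transpose_mat G *\<^sub>v unit_vec q
        j) $ i" by simp
    moreover have "(E *\<^sub>v unit_vec q j) $ i = E $$ (i, j)" if "E \<in> carrier_mat n q" for E :: "real
        mat"
      using that ij by simp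
    ultimately show "(Z * Bi * transpose_mat G) $$ (i, j) = transpose_mat G $$ (i, j)"
      using Gt mult_carrier_mat[OF mult_carrier_mat[OF Z(1) Bi(1)] Gt] by metis
  qed (use Z G in auto)
  have "transpose_mat (Z * Bi * transpose_mat G) = G * (Bi * Z)"
    using Z Bi G by (simp add: transpose_mult_dim)
  then have "G * (Bi * Z) = G" using 1 by simp
  moreover have "(G * (Bi * Z)) *\<^sub>v v = G *\<^sub>v (Bi *\<^sub>v (Z *\<^sub>v v))"
    using Z Bi G v by (simp add: assoc_mult_mat_vec_dim)
  ultimately show ?thesis by simp
qed

text \<open>Since \<open>M\<close> commutes with its pseudoinverse \<open>M\<^sup>+\<close>, one has \<open>M\<^sup>+ = M M\<^sup>+ M\<^sup>+\<close>, which exposes a factor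
\<open>G\<^sup>T G\<close> on the left of \<open>Z\<close>.\<close>

lemma Z_in_range:
  assumes v: "v \<in> carrier_vec n"
  obtains u where "u \<in> carrier_vec n" "transpose_mat G *\<^sub>v (G *\<^sub>v u) = Z *\<^sub>v v"
proof (rule that)
  let ?u = "Bi *\<^sub>v (transpose_mat G *\<^sub>v (gram_pinv *\<^sub>v (gram_pinv *\<^sub>v (G *\<^sub>v v))))"
  show "?u \<in> carrier_vec n" using Bi G gram_pinv v by simp
  show "transpose_mat G *\<^sub>v (G *\<^sub>v ?u) = Z *\<^sub>v v"
    using pinv_eqs_vec(1)[of "G *\<^sub>v v"] pinv_eqs_vec(3)[of "gram_pinv *\<^sub>v (G *\<^sub>v v)"] v G gram_pinv
        Z_vec[OF v] by simp
qed

lemma ip_Bi_Z: "v \<in> carrier_vec n \<Longrightarrow> ip_B Bi (Z *\<^sub>v v) (Z *\<^sub>v v) = ip_B Z v v"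
  unfolding ip_B_def using transpose_adjoint_dim[of v Z "Bi *\<^sub>v (Z *\<^sub>v v)"] Z Bi Z_Bi_Z by simp

lemma ip_B_BiZ:
  assumes v: "v \<in> carrier_vec n" and w: "w \<in> carrier_vec n"
  shows "ip_B B (Bi *\<^sub>v (Z *\<^sub>v v)) w = ip_B Z v w"
proof -
  have "ip_B B (Bi *\<^sub>v (Z *\<^sub>v v)) w = (B *\<^sub>v (Bi *\<^sub>v (Z *\<^sub>v v))) \<bullet> w"
    unfolding ip_B_def using transpose_adjoint_dim[of "Bi *\<^sub>v (Z *\<^sub>v v)" B w] B Bi Z v w by simp
  also have "\<dots> = ip_B Z v w"
    unfolding ip_B_def using B_Bi_vec Z v w transpose_adjoint_dim[of v Z w] by simp
  finally show ?thesis .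
qed

lemma ip_B_BiZ_BiZ:
  assumes v: "v \<in> carrier_vec n"
  shows "ip_B B (Bi *\<^sub>v (Z *\<^sub>v v)) (Bi *\<^sub>v (Z *\<^sub>v v)) = ip_B Z v v"
proof -
  have "ip_B B (Bi *\<^sub>v (Z *\<^sub>v v)) (Bi *\<^sub>v (Z *\<^sub>v v)) = ip_B Z v (Bi *\<^sub>v (Z *\<^sub>v v))"
    by (rule ip_B_BiZ) (use v Bi Z in auto)
  also have "\<dots> = ip_B Z v v" unfolding ip_B_def using Z_Bi_Z[OF v] by simp
  finally show ?thesis .
qed

lemma Z_nonneg: "v \<in> carrier_vec n \<Longrightarrow> ip_B Z v v \<ge> 0"
  using ip_Bi_Z spd_ip_nonneg[OF spd_mat_inv(1)[OF spd]] Z by (metis mult_mat_vec_carrier)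

text \<open>The gap is the squared \<open>B\<close>-norm of \<open>v - B\<inverse> Z v\<close>.\<close>

lemma Z_le_B:
  assumes v: "v \<in> carrier_vec n"
  shows "ip_B Z v v \<le> ip_B B v v"
proof -
  let ?p = "Bi *\<^sub>v (Z *\<^sub>v v)"
  have p: "?p \<in> carrier_vec n" using Bi Z v by simp
  have "0 \<le> ip_B B (v - ?p) (v - ?p)" by (rule spd_ip_nonneg[OF spd]) (use v p in auto)
  also have "\<dots> = ip_B B v v - 2 * ip_B B ?p v + ip_B B ?p ?p"
    using v p B ip_B_sym[OF B v p] by (simp add: ip_B_bilinear)
  finally show ?thesis unfolding ip_B_BiZ[OF v v] ip_B_BiZ_BiZ[OF v] by simp
qed

lemma Z_kernel: "v \<in> carrier_vec n \<Longrightarrow> G *\<^sub>v v = 0\<^sub>v q \<Longrightarrow> Z *\<^sub>v v = 0\<^sub>v n"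
proof -
  assume v: "v \<in> carrier_vec n" "G *\<^sub>v v = 0\<^sub>v q"
  have "E *\<^sub>v 0\<^sub>v c = 0\<^sub>v r" if "E \<in> carrier_mat r c" for E :: "real mat" and r c
    using that by (intro eq_vecI) auto
  then show ?thesis using Z_vec[OF v(1)] v(2) gram_pinv G by (metis transpose_carrier_mat)
qed

text \<open>Expanding the square, the right-hand side exceeds the left-hand side by
\<open>(\<beta> + \<beta>\<^sup>2) |d + e|\<^sup>2 + \<omega>\<beta> (d - e)\<^sup>T Z (d - e)\<close>. The second term is the convexity of the sketched
objective, the first one the bound \<open>|d - e|\<^sup>2 \<le> 2 |d|\<^sup>2 + 2 |e|\<^sup>2\<close>.\<close>

lemma momentum_step:
  assumes d: "d \<in> carrier_vec n" and e: "e \<in> carrier_vec n" and \<beta>: "\<beta> \<ge> 0" and \<omega>: "\<omega> \<ge> 0"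
  defines "w \<equiv> d - \<omega> \<cdot>\<^sub>v (Bi *\<^sub>v (Z *\<^sub>v d)) + \<beta> \<cdot>\<^sub>v (d - e)"
  shows "ip_B B w w \<le> (1 + 3 * \<beta> + 2 * \<beta>\<^sup>2) * ip_B B d d + (\<beta> + 2 * \<beta>\<^sup>2) * ip_B B e e
    - (\<omega> * (2 - \<omega>) + \<omega> * \<beta>) * ip_B Z d d + \<omega> * \<beta> * ip_B Z e e"
proof -
  let ?p = "Bi *\<^sub>v (Z *\<^sub>v d)"
  have p: "?p \<in> carrier_vec n" using Bi Z d by simp
  define a where "a = ip_B B d d"
  define c where "c = ip_B B d e"
  define g where "g = ip_B B e e"
  define z where "z = ip_B Z d d"
  define y where "y = ip_B Z d e"
  define t where "t = ip_B Z e e"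
  have defs: "ip_B B d d = a" "ip_B B d e = c" "ip_B B e d = c" "ip_B B e e = g"
    "ip_B B ?p ?p = z" "ip_B B ?p d = z" "ip_B B d ?p = z" "ip_B B ?p e = y" "ip_B B e ?p = y"
    "ip_B Z d d = z" "ip_B Z d e = y" "ip_B Z e d = y" "ip_B Z e e = t"
    using ip_B_sym[OF B] ip_B_sym[OF Z] ip_B_BiZ[OF d] ip_B_BiZ_BiZ[OF d] d e p
    by (auto simp: a_def c_def g_def z_def y_def t_def)
  have w: "ip_B B w w = (1 + \<beta>)\<^sup>2 * a + \<beta>\<^sup>2 * g + \<omega>\<^sup>2 * z - 2 * (1 + \<beta>) * \<beta> * c
     - 2 * \<omega> * (1 + \<beta>) * z + 2 * \<omega> * \<beta> * y"
    unfolding w_def using d e p B by (simp add: ip_B_bilinear defs algebra_simps power2_eq_square)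
  have "0 \<le> ip_B B (d + e) (d + e)" by (rule spd_ip_nonneg[OF spd]) (use d e in auto)
  also have "\<dots> = a + g + 2 * c" using d e B by (simp add: ip_B_bilinear defs)
  finally have 1: "0 \<le> (\<beta> + \<beta>\<^sup>2) * (a + g + 2 * c)" using \<beta> by simp
  have "0 \<le> ip_B Z (d - e) (d - e)" by (rule Z_nonneg) (use d e in auto)
  also have "\<dots> = z + t - 2 * y" using d e Z by (simp add: ip_B_bilinear defs)
  finally have 2: "0 \<le> \<omega> * \<beta> * (z + t - 2 * y)" using \<beta> \<omega> by simp
  show ?thesis unfolding w defs using 1 2 by (simp add: algebra_simps power2_eq_square)
qed

text \<open>The pseudoinverse-free lower bound for \<open>v\<^sup>T Z v\<close> obtained by testing the concave function
\<open>y \<mapsto> 2 v\<^sup>T G\<^sup>T y - y\<^sup>T G B\<inverse> G\<^sup>T y\<close>, whose maximum is \<open>v\<^sup>T Z v\<close>, at the point \<open>y = G u\<close>. Restricting to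
such \<open>y\<close> keeps the test vector \<open>u\<close> in a space that does not depend on the number of rows of \<open>G\<close>.\<close>

definition sup_form where
  "sup_form v u = 2 * ip_B (transpose_mat G * G) v u
     - ip_B Bi ((transpose_mat G * G) *\<^sub>v u) ((transpose_mat G * G) *\<^sub>v u)"

lemma sup_form_gap:
  assumes v: "v \<in> carrier_vec n" and u: "u \<in> carrier_vec n"
  shows "ip_B Z v v - sup_form v u =
    ip_B Bi (Z *\<^sub>v v - (transpose_mat G * G) *\<^sub>v u) (Z *\<^sub>v v - (transpose_mat G * G) *\<^sub>v u)"
proof -
  let ?C = "transpose_mat G * G"
  have C: "?C \<in> carrier_mat n n" using G by simp
  have Cu: "?C *\<^sub>v u \<in> carrier_vec n" and Zv: "Z *\<^sub>v v \<in> carrier_vec n" using C Z u v by auto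
  have "Z *\<^sub>v (Bi *\<^sub>v (?C *\<^sub>v u)) = ?C *\<^sub>v u"
    using Z_Bi_Gt[of "G *\<^sub>v u"] G u by (simp add: assoc_mult_mat_vec_dim)
  then have cross: "ip_B Bi (Z *\<^sub>v v) (?C *\<^sub>v u) = ip_B ?C v u"
    unfolding ip_B_def using transpose_adjoint_dim[of v Z "Bi *\<^sub>v (?C *\<^sub>v u)"] Z v Bi by simp
  show ?thesis unfolding sup_form_def
    using cross ip_B_sym[OF Bi Zv Cu] ip_Bi_Z[OF v] Zv Cu Bi by (simp add: ip_B_bilinear)
qed

end

section \<open>The projection form as a countable supremum\<close>

text \<open>Rational vectors are indexed by lists of rationals, a countable type. A list shorter than \<open>n\<close> gives
some rational vector, too, because \<open>nth\<close> is total.\<close>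

definition rat_vec :: "nat \<Rightarrow> rat list \<Rightarrow> real vec" where
  "rat_vec n l = vec n (\<lambda>i. of_rat (l ! i))"

lemma rat_vec_carrier [simp]: "rat_vec n l \<in> carrier_vec n"
  by (simp add: rat_vec_def)

lemma rat_sequence_tendsto: "\<exists>r :: nat \<Rightarrow> rat. (\<lambda>j. of_rat (r j)) \<longlonglongrightarrow> (x :: real)"
proof -
  have "\<exists>q. x < of_rat q \<and> of_rat q < x + 1 / real (Suc j)" for j
    by (rule of_rat_dense) simp
  then obtain r where r: "\<And>j. x < of_rat (r j)" "\<And>j. of_rat (r j) < x + 1 / real (Suc j)" by metis
  have "(\<lambda>j. x + 1 / real (Suc j)) \<longlonglongrightarrow> x + 0"
    by (intro tendsto_add tendsto_const LIMSEQ_Suc[OF lim_1_over_n])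
  then have lim: "(\<lambda>j. x + 1 / real (Suc j)) \<longlonglongrightarrow> x" by simp
  have "(\<lambda>j. of_rat (r j)) \<longlonglongrightarrow> x"
    by (rule tendsto_sandwich[OF _ _ tendsto_const lim]; intro always_eventually allI less_imp_le r)
  then show ?thesis by blast
qed

lemma rat_vec_dense_form:
  fixes E :: "real mat"
  assumes E: "E \<in> carrier_mat n n" and u: "u \<in> carrier_vec n" and e: "e > 0"
  shows "\<exists>l. ip_B E (u - rat_vec n l) (u - rat_vec n l) < e"
proof -
  obtain r :: "nat \<Rightarrow> nat \<Rightarrow> rat" where r: "\<And>i. (\<lambda>j. of_rat (r i j)) \<longlonglongrightarrow> u $ i"
    using choice[OF allI[OF rat_sequence_tendsto], of "\<lambda>i. u $ i"] by blast
  define w where "w j = u - rat_vec n (map (\<lambda>i. r i j) [0..<n])" for j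
  have w: "w j \<in> carrier_vec n" for j using u by (simp add: w_def)
  have wi: "(\<lambda>j. w j $ i) \<longlonglongrightarrow> 0" if i: "i < n" for i
  proof -
    have "w j $ i = u $ i - of_rat (r i j)" for j using i u by (simp add: w_def rat_vec_def)
    then show ?thesis using tendsto_diff[OF tendsto_const[of "u $ i"] r[of i]] by simp
  qed
  have "(\<lambda>j. ip_B E (w j) (w j)) \<longlonglongrightarrow> (\<Sum>i<n. \<Sum>k<n. E $$ (i, k) * (0 * 0))"
    unfolding ip_B_entries[OF E w w]
    by (intro tendsto_sum tendsto_mult tendsto_const wi) auto
  then have "eventually (\<lambda>j. ip_B E (w j) (w j) < e) sequentially"
    using e by (intro order_tendstoD) simp_all
  then show ?thesis unfolding w_def by (auto simp: eventually_sequentially)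
qed

context weighted_row_projection
begin

text \<open>The supremum of \<open>sup_form v\<close> is attained at any \<open>u\<close> with \<open>G\<^sup>T G u = Z v\<close>, and by continuity it is
approached along rational vectors. So the strict inequality is a countable union of conditions
that are polynomial in \<open>G\<^sup>T G\<close>.\<close>

lemma Z_less_iff_sup_form:
  assumes v: "v \<in> carrier_vec n"
  shows "a < ip_B Z v v \<longleftrightarrow> (\<exists>l. a < sup_form v (rat_vec n l))"
proof
  assume "\<exists>l. a < sup_form v (rat_vec n l)"
  then obtain l where l: "a < sup_form v (rat_vec n l)" by blast
  let ?p = "Z *\<^sub>v v - (transpose_mat G * G) *\<^sub>v rat_vec n l"
  have C: "transpose_mat G * G \<in> carrier_mat n n" using G by simp
  have "?p \<in> carrier_vec n"
    by (rule minus_carrier_vec[OF mult_mat_vec_carrier[OF Z(1) v] mult_mat_vec_carrier[OF C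
        rat_vec_carrier]])
  then have "ip_B Bi ?p ?p \<ge> 0" by (rule spd_ip_nonneg[OF spd_mat_inv(1)[OF spd]])
  then show "a < ip_B Z v v" using sup_form_gap[OF v rat_vec_carrier, of l] l by linarith
next
  assume a: "a < ip_B Z v v"
  let ?C = "transpose_mat G * G"
  have C: "?C \<in> carrier_mat n n" "transpose_mat ?C = ?C" using G by (auto simp: transpose_mult_dim)
  \<comment> \<open>The gap at \<open>u'\<close> is the form of \<open>C B\<inverse> C\<close> at \<open>u - u'\<close>, where \<open>u\<close> is a maximizer.\<close>
  let ?E = "?C * Bi * ?C"
  have E: "?E \<in> carrier_mat n n" using C(1) Bi by simp
  obtain u where u: "u \<in> carrier_vec n" "transpose_mat G *\<^sub>v (G *\<^sub>v u) = Z *\<^sub>v v"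
    using Z_in_range[OF v] .
  obtain l where l: "ip_B ?E (u - rat_vec n l) (u - rat_vec n l) < ip_B Z v v - a"
    using rat_vec_dense_form[OF E u(1), of "ip_B Z v v - a"] a by auto
  let ?w = "u - rat_vec n l"
  have w: "?w \<in> carrier_vec n" using u by simp
  have Cu: "?C *\<^sub>v u = Z *\<^sub>v v" using u G by (simp add: assoc_mult_mat_vec_dim)
  have Cw: "?C *\<^sub>v ?w = Z *\<^sub>v v - ?C *\<^sub>v rat_vec n l"
    unfolding Cu[symmetric] by (rule mult_minus_distrib_mat_vec[OF C(1) u(1)]) simp
  have "ip_B ?E ?w ?w = ?w \<bullet> (?C *\<^sub>v (Bi *\<^sub>v (?C *\<^sub>v ?w)))"
    unfolding ip_B_def
    using assoc_mult_mat_vec[of "?C * Bi" n n ?C n ?w] assoc_mult_mat_vec[of ?C n n Bi n "?C *\<^sub>v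
        ?w"] C Bi w
    by simp
  also have "\<dots> = ip_B Bi (?C *\<^sub>v ?w) (?C *\<^sub>v ?w)"
    unfolding ip_B_def using transpose_adjoint_dim[of ?w ?C "Bi *\<^sub>v (?C *\<^sub>v ?w)"] C w Bi G u by simp
  finally have "ip_B Bi (?C *\<^sub>v ?w) (?C *\<^sub>v ?w) < ip_B Z v v - a" using l by simp
  then show "\<exists>l. a < sup_form v (rat_vec n l)"
    using sup_form_gap[OF v rat_vec_carrier, of l] unfolding Cw by (intro exI[of _ l]) simp
qed

lemma Z_polarization:
  assumes i: "i < n" and j: "j < n"
  shows "Z $$ (i, j) = (ip_B Z (unit_vec n i + unit_vec n j) (unit_vec n i + unit_vec n j)
    - ip_B Z (unit_vec n i) (unit_vec n i) - ip_B Z (unit_vec n j) (unit_vec n j)) / 2"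
proof -
  have "ip_B Z (unit_vec n i) (unit_vec n j) = Z $$ (i, j)"
    using Z i j by (simp add: ip_B_def)
  moreover have "ip_B Z (unit_vec n j) (unit_vec n i) = ip_B Z (unit_vec n i) (unit_vec n j)"
    using ip_B_sym[OF Z] by simp
  ultimately show ?thesis using Z i j by (simp add: ip_B_bilinear)
qed

lemma Z_entry_bound:
  assumes i: "i < n" and j: "j < n"
  shows "\<bar>Z $$ (i, j)\<bar> \<le> ip_B B (unit_vec n i + unit_vec n j) (unit_vec n i + unit_vec n j)
    + ip_B B (unit_vec n i) (unit_vec n i) + ip_B B (unit_vec n j) (unit_vec n j)"
proof -
  have "unit_vec n i + unit_vec n j \<in> carrier_vec n" "unit_vec n i \<in> carrier_vec n" "unit_vec n j
      \<in> carrier_vec n"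
    by auto
  then show ?thesis unfolding Z_polarization[OF i j]
    using Z_nonneg[of "unit_vec n i"] Z_nonneg[of "unit_vec n j"] Z_nonneg[of "unit_vec n i +
        unit_vec n j"]
      Z_le_B[of "unit_vec n i"] Z_le_B[of "unit_vec n j"] Z_le_B[of "unit_vec n i + unit_vec n j"]
    by (simp add: abs_le_iff)
qed

end

section \<open>Measurability in the sketch\<close>

lemma space_mat_borel: "space (mat_borel m) = {S. dim_row S = m}"
  unfolding mat_borel_def by (rule space_measure_of) auto

lemma carrier_mat_in_sets: "carrier_mat m q \<in> sets (mat_borel m)"
proof -
  have "range (carrier_mat m) \<union> {{S \<in> carrier_mat m q. S $$ (i, j) \<le> a} | q i j a. i < m \<and> j < q}
      \<subseteq> Pow {S :: real mat. dim_row S = m}" by auto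
  then show ?thesis unfolding mat_borel_def by (subst sets_measure_of) auto
qed

lemma entry_le_in_sets:
  assumes "i < m" "j < q"
  shows "{S \<in> carrier_mat m q. S $$ (i, j) \<le> a} \<in> sets (mat_borel m)"
proof -
  have *: "range (carrier_mat m) \<union> {{S \<in> carrier_mat m q. S $$ (i, j) \<le> a} | q i j a. i < m \<and> j < q}
      \<subseteq> Pow {S :: real mat. dim_row S = m}" by auto
  then show ?thesis
    unfolding mat_borel_def sets_measure_of[OF *] using assms
    by (intro sigma_sets.Basic UnI2) blast
qed

lemma measurable_dim_col: "dim_col \<in> measurable (mat_borel m) (count_space UNIV)"
proof (rule measurable_count_space_eq2_countable[THEN iffD2], intro conjI ballI)
  fix q :: nat
  have "dim_col -` {q} \<inter> space (mat_borel m) = carrier_mat m q"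
    by (auto simp: space_mat_borel)
  then show "dim_col -` {q} \<inter> space (mat_borel m) \<in> sets (mat_borel m)"
    using carrier_mat_in_sets by metis
qed auto

lemma measurable_entry:
  assumes i: "i < m"
  shows "(\<lambda>S. if j < dim_col S then S $$ (i, j) else 0 :: real) \<in> borel_measurable (mat_borel m)"
proof (rule borel_measurableI_le)
  fix a :: real
  let ?f = "\<lambda>S :: real mat. if j < dim_col S then S $$ (i, j) else 0"
  have "{S \<in> space (mat_borel m). ?f S \<le> a}
    = (\<Union>q. if j < q then {S \<in> carrier_mat m q. S $$ (i, j) \<le> a} else if 0 \<le> a then carrier_mat m q
        else {})"
    by (auto simp: space_mat_borel split: if_splits)
  also have "\<dots> \<in> sets (mat_borel m)"
    using entry_le_in_sets[OF i] carrier_mat_in_sets by (intro sets.countable_UN) auto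
  finally show "{S \<in> space (mat_borel m). ?f S \<le> a} \<in> sets (mat_borel m)" .
qed

text \<open>The number of summands depends on \<open>S\<close>, but it is a measurable function with countable range.\<close>

lemma measurable_gram_entry:
  assumes i: "i < m" and k: "k < m"
  shows "(\<lambda>S. (S * transpose_mat S) $$ (i, k) :: real) \<in> borel_measurable (mat_borel m)"
proof -
  let ?e = "\<lambda>i j S :: real mat. if j < dim_col S then S $$ (i, j) else 0"
  have f: "(\<lambda>S. \<Sum>j<dim_col S. ?e i j S * ?e k j S) \<in> borel_measurable (mat_borel m)"
  proof (rule measurable_compose_countable[where f = "\<lambda>q S. \<Sum>j<q. ?e i j S * ?e k j S", OF _
      measurable_dim_col])
    fix q :: nat
    show "(\<lambda>S. \<Sum>j<q. ?e i j S * ?e k j S) \<in> borel_measurable (mat_borel m)"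
      using measurable_entry[OF i] measurable_entry[OF k]
      by (intro borel_measurable_sum borel_measurable_times)
  qed
  have eq: "(\<Sum>j<dim_col S. ?e i j S * ?e k j S) = (S * transpose_mat S) $$ (i, k)"
    if "S \<in> space (mat_borel m)" for S :: "real mat"
    using that i k by (auto simp: space_mat_borel scalar_prod_def atLeast0LessThan intro!: sum.cong)
  show ?thesis using measurable_cong[THEN iffD1, OF eq f] by simp
qed

locale sketching =
  fixes m n :: nat and A B :: "real mat"
  assumes A: "A \<in> carrier_mat m n" and spd: "spd_mat n B"
begin

lemma B: "B \<in> carrier_mat n n" "transpose_mat B = B"
  and Bi: "mat_inv B \<in> carrier_mat n n" "transpose_mat (mat_inv B) = mat_inv B"
  using spd spd_mat_inv(1)[OF spd] by (auto simp: spd_mat_def)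

lemma sketch_projection:
  assumes "dim_row S = m"
  shows "weighted_row_projection n (dim_col S) B (transpose_mat S * A)"
  by unfold_locales (use spd A assms in auto)

lemma H_mat_eq:
  assumes S: "dim_row S = m"
  shows "H_mat A B S
    = S * weighted_row_projection.gram_pinv B (transpose_mat S * A) * transpose_mat S"
proof -
  interpret weighted_row_projection n "dim_col S" B "transpose_mat S * A"
    by (rule sketch_projection[OF S])
  have "transpose_mat S * A * mat_inv B * transpose_mat A * S
    = transpose_mat S * A * mat_inv B * transpose_mat (transpose_mat S * A)"
    using A S Bi by (simp add: transpose_mult_dim assoc_mult_mat_dim)
  then show ?thesis unfolding H_mat_def gram_pinv_def by simp
qed

lemma Z_mat_eq:
  assumes S: "dim_row S = m"
  shows "Z_mat A B S = weighted_row_projection.Z B (transpose_mat S * A)"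
proof -
  interpret weighted_row_projection n "dim_col S" B "transpose_mat S * A"
    by (rule sketch_projection[OF S])
  show ?thesis
    unfolding Z_mat_def Z_def H_mat_eq[OF S] using A S gram_pinv
    by (simp add: transpose_mult_dim assoc_mult_mat_dim)
qed

text \<open>The kernel property reflects that a sketch sees \<open>v\<close> only through \<open>A v\<close>.\<close>

lemma Z_mat:
  assumes S: "dim_row S = m"
  shows "Z_mat A B S \<in> carrier_mat n n" "transpose_mat (Z_mat A B S) = Z_mat A B S"
    "v \<in> carrier_vec n \<Longrightarrow> ip_B (Z_mat A B S) v v \<ge> 0"
    "v \<in> carrier_vec n \<Longrightarrow> A *\<^sub>v v = 0\<^sub>v m \<Longrightarrow> Z_mat A B S *\<^sub>v v = 0\<^sub>v n"
proof -
  interpret weighted_row_projection n "dim_col S" B "transpose_mat S * A"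
    by (rule sketch_projection[OF S])
  show "Z_mat A B S \<in> carrier_mat n n" "transpose_mat (Z_mat A B S) = Z_mat A B S"
    "v \<in> carrier_vec n \<Longrightarrow> ip_B (Z_mat A B S) v v \<ge> 0"
    unfolding Z_mat_eq[OF S] using Z Z_nonneg by auto
  show "Z_mat A B S *\<^sub>v v = 0\<^sub>v n" if "v \<in> carrier_vec n" "A *\<^sub>v v = 0\<^sub>v m"
    unfolding Z_mat_eq[OF S]
  proof (rule Z_kernel[OF that(1)])
    have "transpose_mat S *\<^sub>v 0\<^sub>v m = 0\<^sub>v (dim_col S)" using S by (intro eq_vecI) auto
    then show "(transpose_mat S * A) *\<^sub>v v = 0\<^sub>v (dim_col S)"
      using that A S by (simp add: assoc_mult_mat_vec_dim)
  qed
qed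

lemma H_mat_carrier:
  assumes S: "dim_row S = m"
  shows "H_mat A B S \<in> carrier_mat m m"
proof -
  interpret weighted_row_projection n "dim_col S" B "transpose_mat S * A"
    by (rule sketch_projection[OF S])
  show ?thesis unfolding H_mat_eq[OF S] using S gram_pinv by auto
qed

text \<open>The matrix \<open>C = G\<^sup>T G = A\<^sup>T (S S\<^sup>T) A\<close> of the supremum formula has a fixed size and measurable
entries, whatever the width of \<open>S\<close>.\<close>

lemma measurable_Z_form:
  assumes v: "v \<in> carrier_vec n"
  shows "(\<lambda>S. ip_B (Z_mat A B S) v v) \<in> borel_measurable (mat_borel m)"
proof -
  let ?C = "\<lambda>S. transpose_mat (transpose_mat S * A) * (transpose_mat S * A)"
  have C: "?C S \<in> carrier_mat n n" for S using A by auto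
  have Centry: "(\<lambda>S. ?C S $$ (i, j)) \<in> borel_measurable (mat_borel m)" if ij: "i < n" "j < n" for
      i j
  proof -
    have eq: "?C S $$ (i, j) = (\<Sum>k<m. \<Sum>l<m. A $$ (k, i) * ((S * transpose_mat S) $$ (k, l) * A $$
        (l, j)))"
      if S: "S \<in> space (mat_borel m)" for S
    proof -
      have S: "dim_row S = m" using S by (auto simp: space_mat_borel)
      have SS: "S * transpose_mat S \<in> carrier_mat m m" using S by auto
      have "?C S = transpose_mat A * ((S * transpose_mat S) * A)"
        using A S by (simp add: transpose_mult_dim assoc_mult_mat_dim)
      moreover have "(transpose_mat A * (N * A)) $$ (i, j) = (\<Sum>k<m. \<Sum>l<m. A $$ (k, i) * (N $$ (k,
          l) * A $$ (l, j)))"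
        if "N \<in> carrier_mat m m" for N :: "real mat"
        using that A ij by (auto simp: scalar_prod_def atLeast0LessThan sum_distrib_left intro!:
            sum.cong)
      ultimately show ?thesis using SS by simp
    qed
    show ?thesis
      by (rule measurable_cong[THEN iffD2, OF eq], assumption)
        (intro borel_measurable_sum borel_measurable_times borel_measurable_const
            measurable_gram_entry; simp)
  qed
  have Cu: "(\<lambda>S. (?C S *\<^sub>v u) $ i) \<in> borel_measurable (mat_borel m)" if u: "u \<in> carrier_vec n" and
      i: "i < n" for u i
  proof -
    have entry: "(N *\<^sub>v u) $ i = (\<Sum>j<n. N $$ (i, j) * u $ j)" if "N \<in> carrier_mat n n" for N ::
        "real mat"
      using that u i by (auto simp: scalar_prod_def atLeast0LessThan intro!: sum.cong)
    show ?thesis unfolding entry[OF C]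
      by (intro borel_measurable_sum borel_measurable_times borel_measurable_const Centry[OF i])
          simp
  qed
  define phi where "phi S u = 2 * ip_B (?C S) v u - ip_B (mat_inv B) (?C S *\<^sub>v u) (?C S *\<^sub>v u)" for
      S u
  have phi: "(\<lambda>S. phi S u) \<in> borel_measurable (mat_borel m)" if u: "u \<in> carrier_vec n" for u
  proof -
    have Cuc: "?C S *\<^sub>v u \<in> carrier_vec n" for S using C u by (rule mult_mat_vec_carrier)
    show ?thesis
      unfolding phi_def ip_B_entries[OF C v u] ip_B_entries[OF Bi(1) Cuc Cuc]
      by (intro borel_measurable_diff borel_measurable_times borel_measurable_const
          borel_measurable_sum Centry Cu[OF u]; simp)
  qed
  show ?thesis
  proof (rule borel_measurableI_greater)
    fix a
    have iff: "a < ip_B (Z_mat A B S) v v \<longleftrightarrow> (\<exists>l. a < phi S (rat_vec n l))" if "S \<in> space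
        (mat_borel m)" for S
    proof -
      have S: "dim_row S = m" using that by (simp add: space_mat_borel)
      interpret weighted_row_projection n "dim_col S" B "transpose_mat S * A"
        by (rule sketch_projection[OF S])
      show ?thesis unfolding Z_mat_eq[OF S] Z_less_iff_sup_form[OF v] sup_form_def phi_def ..
    qed
    have "{S \<in> space (mat_borel m). a < ip_B (Z_mat A B S) v v}
      = {S \<in> space (mat_borel m). \<exists>l. a < phi S (rat_vec n l)}"
      by (rule Collect_cong) (simp only: iff cong: conj_cong)
    also have "\<dots> = (\<Union>l. {S \<in> space (mat_borel m). a < phi S (rat_vec n l)})"
      by (simp only: Collect_ex_eq[symmetric] ex_simps)
    also have "\<dots> \<in> sets (mat_borel m)"
      using phi by (intro sets.countable_UN'') auto
    finally show "{S \<in> space (mat_borel m). a < ip_B (Z_mat A B S) v v} \<in> sets (mat_borel m)" .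
  qed
qed

lemma measurable_Z_entry:
  assumes ij: "i < n" "j < n"
  shows "(\<lambda>S. Z_mat A B S $$ (i, j)) \<in> borel_measurable (mat_borel m)"
proof -
  let ?q = "\<lambda>v S. ip_B (Z_mat A B S) v v"
  have f: "(\<lambda>S. (?q (unit_vec n i + unit_vec n j) S - ?q (unit_vec n i) S - ?q (unit_vec n j) S) /
      2)
    \<in> borel_measurable (mat_borel m)"
    by (intro borel_measurable_diff borel_measurable_divide measurable_Z_form
        borel_measurable_const) auto
  have eq: "(?q (unit_vec n i + unit_vec n j) S - ?q (unit_vec n i) S - ?q (unit_vec n j) S) / 2 =
      Z_mat A B S $$ (i, j)"
    if "S \<in> space (mat_borel m)" for S
  proof -
    have S: "dim_row S = m" using that by (simp add: space_mat_borel)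
    interpret weighted_row_projection n "dim_col S" B "transpose_mat S * A"
      by (rule sketch_projection[OF S])
    show ?thesis unfolding Z_mat_eq[OF S] using Z_polarization[OF ij] by simp
  qed
  show ?thesis using measurable_cong[THEN iffD1, OF eq f] by simp
qed

lemma Z_entry_bounded:
  assumes ij: "i < n" "j < n"
  shows "\<exists>C. \<forall>S \<in> space (mat_borel m). \<bar>Z_mat A B S $$ (i, j)\<bar> \<le> C"
proof (intro exI ballI)
  fix S assume "S \<in> space (mat_borel m)"
  then have S: "dim_row S = m" by (simp add: space_mat_borel)
  interpret weighted_row_projection n "dim_col S" B "transpose_mat S * A"
    by (rule sketch_projection[OF S])
  show "\<bar>Z_mat A B S $$ (i, j)\<bar> \<le> ip_B B (unit_vec n i + unit_vec n j) (unit_vec n i + unit_vec n j)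
    + ip_B B (unit_vec n i) (unit_vec n i) + ip_B B (unit_vec n j) (unit_vec n j)"
    unfolding Z_mat_eq[OF S] by (rule Z_entry_bound[OF ij])
qed

end

section \<open>Linear recurrences of order two\<close>

text \<open>Because \<open>q\<^sup>2 = a1 * q + a2\<close>, the number \<open>\<delta> = q - a1\<close> satisfies \<open>q * \<delta> = a2\<close>, and the two-term
recurrence becomes a one-term one for the potential \<open>F (Suc k) + \<delta> * F k\<close>.\<close>

lemma momentum_recurrence:
  fixes F :: "nat \<Rightarrow> real"
  assumes a2: "a2 \<ge> 0" and a12: "a1 + a2 < 1" and pos: "\<And>k. F k \<ge> 0" and start: "F 1 = F 0"
    and step: "\<And>k. F (Suc (Suc k)) \<le> a1 * F (Suc k) + a2 * F k"
    and q: "q = (a1 + sqrt (a1\<^sup>2 + 4 * a2)) / 2" and \<delta>: "\<delta> = q - a1"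
  shows "F (Suc k) \<le> q ^ k * (1 + \<delta>) * F 0" "0 \<le> q" "a1 + a2 \<le> q" "q < 1"
proof -
  let ?r = "sqrt (a1\<^sup>2 + 4 * a2)"
  have r2: "?r\<^sup>2 = a1\<^sup>2 + 4 * a2" using a2 by simp
  have "sqrt (a1\<^sup>2) \<le> ?r" using a2 by (intro real_sqrt_le_mono) simp
  then have r: "\<bar>a1\<bar> \<le> ?r" by simp
  show q0: "0 \<le> q" unfolding q using r by simp
  have d0: "0 \<le> \<delta>" unfolding \<delta> q using r by (simp add: field_simps)
  have q\<delta>: "q * \<delta> = a2"
  proof -
    have "q * \<delta> = (?r\<^sup>2 - a1\<^sup>2) / 4" unfolding \<delta> q by (simp add: field_simps power2_eq_square)
    then show ?thesis using r2 by simp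
  qed
  \<comment> \<open>This is \<open>a1 + a2 \<le> q\<close>. If the left side is positive, squaring leaves \<open>a2 * (1 - a1 - a2) \<ge> 0\<close>.\<close>
  have "a1 + 2 * a2 \<le> ?r"
  proof (cases "a1 + 2 * a2 \<le> 0")
    case True
    then show ?thesis using r by linarith
  next
    case False
    have "0 \<le> a2 * (1 - a1 - a2)" using a2 a12 by simp
    then have "(a1 + 2 * a2)\<^sup>2 \<le> a1\<^sup>2 + 4 * a2" by (simp add: power2_eq_square algebra_simps)
    then show ?thesis by (rule real_le_rsqrt)
  qed
  then show "a1 + a2 \<le> q" unfolding q by simp
  have "?r < 2 - a1"
  proof (rule real_less_lsqrt)
    show "a1\<^sup>2 + 4 * a2 < (2 - a1)\<^sup>2" using a12 by (simp add: power2_eq_square algebra_simps)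
  qed (use a2 a12 in auto)
  then show "q < 1" unfolding q by simp
  have main: "F (Suc k) + \<delta> * F k \<le> q ^ k * ((1 + \<delta>) * F 0)" for k
  proof (induction k)
    case 0
    then show ?case using start by (simp add: algebra_simps)
  next
    case (Suc k)
    have "F (Suc (Suc k)) + \<delta> * F (Suc k) \<le> (a1 + \<delta>) * F (Suc k) + a2 * F k"
      using step[of k] by (simp add: algebra_simps)
    also have "\<dots> = q * (F (Suc k) + \<delta> * F k)"
      unfolding q\<delta>[symmetric] by (simp add: \<delta> algebra_simps)
    also have "\<dots> \<le> q * (q ^ k * ((1 + \<delta>) * F 0))" by (rule mult_left_mono[OF Suc q0])
    finally show ?case by simp
  qed
  have "0 \<le> \<delta> * F k" using d0 pos by simp
  then show "F (Suc k) \<le> q ^ k * (1 + \<delta>) * F 0" using main[of k] by (simp add: mult.assoc)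
qed

section \<open>Extreme eigenvalues\<close>

text \<open>In an orthonormal eigenbasis the form is a weighted sum of squared coordinates with the eigenvalues
as weights; orthogonality to the kernel removes the coordinates of weight zero.\<close>

lemma symmetric_rayleigh:
  fixes M :: "real mat"
  assumes M: "M \<in> carrier_mat n n" "transpose_mat M = M" and u: "u \<in> carrier_vec n"
  shows "ip_B M u u \<le> lambda_max M * (u \<bullet> u)"
    and "(\<And>w. w \<in> carrier_vec n \<Longrightarrow> M *\<^sub>v w = 0\<^sub>v n \<Longrightarrow> w \<bullet> u = 0) \<Longrightarrow>
      lambda_min_plus M * (u \<bullet> u) \<le> ip_B M u u"
proof -
  obtain U d where U: "U \<in> carrier_mat n n" and UU: "transpose_mat U * U = 1\<^sub>m n"
    and Md: "M = U * mat_diag n d * transpose_mat U"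
    using real_symmetric_diagonalization[OF M] by blast
  have ev: "{l. eigenvalue M l} = d ` {..<n}"
    unfolding Md eigenvalue_orthogonal_conj_diag[OF U UU] by auto
  have ev': "{l. eigenvalue M l \<and> l \<noteq> 0} = d ` {..<n} - {0}" using ev by auto
  let ?c = "\<lambda>i. ((transpose_mat U *\<^sub>v u) $ i)\<^sup>2"
  have form: "ip_B M u u = (\<Sum>i<n. d i * ?c i)"
    unfolding Md by (rule orthogonal_conj_diag_form[OF U u])
  have nrm: "u \<bullet> u = (\<Sum>i<n. ?c i)" by (rule orthogonal_norm_sum[OF U UU u])
  show "ip_B M u u \<le> lambda_max M * (u \<bullet> u)"
    unfolding form nrm sum_distrib_left
    by (intro sum_mono mult_right_mono) (auto simp: lambda_max_def ev intro!: Max_ge)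
  assume orth: "\<And>w. w \<in> carrier_vec n \<Longrightarrow> M *\<^sub>v w = 0\<^sub>v n \<Longrightarrow> w \<bullet> u = 0"
  show "lambda_min_plus M * (u \<bullet> u) \<le> ip_B M u u"
    unfolding form nrm sum_distrib_left
  proof (rule sum_mono)
    fix i assume "i \<in> {..<n}"
    then have i: "i < n" by simp
    show "lambda_min_plus M * ?c i \<le> d i * ?c i"
    proof (cases "d i = 0")
      case True
      have "M *\<^sub>v col U i = 0\<^sub>v n"
        unfolding Md orthogonal_col(4)[OF U UU i] True using U i by (intro eq_vecI) auto
      then have "col U i \<bullet> u = 0" using orth U i by simp
      then have "?c i = 0" using U u i by simp
      then show ?thesis by simp
    next
      case False
      then have "lambda_min_plus M \<le> d i"
        unfolding lambda_min_plus_def ev' using i by (intro Min_le) auto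
      then show ?thesis by (rule mult_right_mono) simp
    qed
  qed
qed

lemma lambda_max_nonneg:
  fixes M :: "real mat"
  assumes M: "M \<in> carrier_mat n n" "transpose_mat M = M" and n: "n > 0"
    and pos: "\<And>u. u \<in> carrier_vec n \<Longrightarrow> ip_B M u u \<ge> 0"
  shows "lambda_max M \<ge> 0"
proof -
  let ?u = "unit_vec n 0 :: real vec"
  have "?u \<bullet> ?u = 1" using n by simp
  then show ?thesis using symmetric_rayleigh(1)[OF M, of ?u] pos[of ?u] by simp
qed

section \<open>Bounded measurable functions\<close>

text \<open>Bounded measurable functions are closed under products, unlike integrable ones, so integrability of
polynomials in the random quantities comes for free.\<close>

definition bounded_measurable :: "'a measure \<Rightarrow> ('a \<Rightarrow> real) \<Rightarrow> bool" where
  "bounded_measurable M f \<longleftrightarrow> f \<in> borel_measurable M \<and> (\<exists>C. \<forall>x \<in> space M. \<bar>f x\<bar> \<le> C)"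

named_theorems bounded_measurable_intros

lemma bounded_measurable_const [bounded_measurable_intros]: "bounded_measurable M (\<lambda>_. c)"
  by (auto simp: bounded_measurable_def)

lemma bounded_measurable_add [bounded_measurable_intros]:
  assumes "bounded_measurable M f" "bounded_measurable M g"
  shows "bounded_measurable M (\<lambda>x. f x + g x)"
proof -
  obtain C D where "\<forall>x \<in> space M. \<bar>f x\<bar> \<le> C" "\<forall>x \<in> space M. \<bar>g x\<bar> \<le> D"
    using assms by (auto simp: bounded_measurable_def)
  then have "\<forall>x \<in> space M. \<bar>f x + g x\<bar> \<le> C + D"
    by (meson abs_triangle_ineq add_mono order_trans)
  then show ?thesis using assms by (auto simp: bounded_measurable_def)
qed

lemma bounded_measurable_mult [bounded_measurable_intros]:
  assumes "bounded_measurable M f" "bounded_measurable M g"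
  shows "bounded_measurable M (\<lambda>x. f x * g x)"
proof -
  obtain C D where "\<forall>x \<in> space M. \<bar>f x\<bar> \<le> C" "\<forall>x \<in> space M. \<bar>g x\<bar> \<le> D"
    using assms by (auto simp: bounded_measurable_def)
  then have "\<forall>x \<in> space M. \<bar>f x * g x\<bar> \<le> C * D"
    by (auto simp: abs_mult intro!: mult_mono order_trans[OF abs_ge_zero])
  then show ?thesis using assms by (auto simp: bounded_measurable_def)
qed

lemma bounded_measurable_diff [bounded_measurable_intros]:
  assumes "bounded_measurable M f" "bounded_measurable M g"
  shows "bounded_measurable M (\<lambda>x. f x - g x)"
  using bounded_measurable_add[OF assms(1) bounded_measurable_mult[OF bounded_measurable_const[of
      M "- 1"] assms(2)]]
  by simp

lemma bounded_measurable_sum [bounded_measurable_intros]: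
  assumes "\<And>i. i \<in> I \<Longrightarrow> bounded_measurable M (f i)"
  shows "bounded_measurable M (\<lambda>x. \<Sum>i\<in>I. f i x)"
  using assms by (induction I rule: infinite_finite_induct)
    (simp_all add: bounded_measurable_const bounded_measurable_add)

lemma bounded_measurable_compose:
  assumes "bounded_measurable N f" "g \<in> measurable M N"
  shows "bounded_measurable M (\<lambda>x. f (g x))"
  using assms measurable_space[OF assms(2)] by (auto simp: bounded_measurable_def)

lemma bounded_measurable_cong:
  assumes "\<And>x. x \<in> space M \<Longrightarrow> f x = g x" "bounded_measurable M g"
  shows "bounded_measurable M f"
  using assms measurable_cong[of M f g borel] by (auto simp: bounded_measurable_def)

lemma (in prob_space) bounded_measurable_integrable:
  assumes "bounded_measurable M f" shows "integrable M f"
proof -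
  obtain C where "\<forall>x \<in> space M. \<bar>f x\<bar> \<le> C" and f: "f \<in> borel_measurable M"
    using assms by (auto simp: bounded_measurable_def)
  then show ?thesis by (intro integrable_const_bound[of _ C]) auto
qed

lemma bounded_measurable_ip:
  fixes u :: "'a \<Rightarrow> real vec"
  assumes E: "E \<in> carrier_mat n n" and u: "\<And>x. u x \<in> carrier_vec n"
    and m: "\<And>i. i < n \<Longrightarrow> bounded_measurable M (\<lambda>x. u x $ i)"
  shows "bounded_measurable M (\<lambda>x. ip_B E (u x) (u x))"
  unfolding ip_B_entries[OF E u u] using m by (intro bounded_measurable_intros) auto

context sketching
begin

lemma bounded_measurable_Z: "i < n \<Longrightarrow> j < n \<Longrightarrow> bounded_measurable (mat_borel m) (\<lambda>S. Z_mat A B S $$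
    (i, j))"
  unfolding bounded_measurable_def using measurable_Z_entry Z_entry_bounded by blast

end

section \<open>The expected sketch\<close>

text \<open>The parameter \<open>xs\<close> is an arbitrary solution of the system, used as the origin.\<close>

locale sketching_method = sketching +
  fixes b :: "real vec" and D :: "real mat measure" and xs :: "real vec"
  assumes xs: "xs \<in> carrier_vec n" "A *\<^sub>v xs = b"
    and D: "prob_space D" and sets_D: "sets D = sets (mat_borel m)"
begin

lemma space_D: "space D = {S. dim_row S = m}"
  using sets_eq_imp_space_eq[OF sets_D] by (simp add: space_mat_borel)

lemma residual:
  assumes x: "x \<in> carrier_vec n"
  shows "A *\<^sub>v x - b = A *\<^sub>v (x - xs)"
  using mult_minus_distrib_mat_vec[OF A x xs(1)] xs(2) by simp

lemma f_sketch_eq: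
  assumes S: "dim_row S = m" and x: "x \<in> carrier_vec n"
  shows "f_sketch A B b S x = ip_B (Z_mat A B S) (x - xs) (x - xs) / 2"
proof -
  note H = H_mat_carrier[OF S]
  let ?w = "x - xs"
  have w: "?w \<in> carrier_vec n" using x xs by simp
  have "(A *\<^sub>v ?w) \<bullet> (H_mat A B S *\<^sub>v (A *\<^sub>v ?w)) = ?w \<bullet> (transpose_mat A *\<^sub>v (H_mat A B S *\<^sub>v (A *\<^sub>v
      ?w)))"
    using transpose_adjoint_dim[of ?w "transpose_mat A" "H_mat A B S *\<^sub>v (A *\<^sub>v ?w)"] A H w xs by simp
  also have "\<dots> = ip_B (Z_mat A B S) ?w ?w"
    unfolding ip_B_def Z_mat_def using A H w xs by (simp add: assoc_mult_mat_vec_dim)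
  finally show ?thesis unfolding f_sketch_def residual[OF x] by simp
qed

lemma grad_sketch_eq:
  assumes S: "dim_row S = m" and x: "x \<in> carrier_vec n"
  shows "grad_sketch A B b S x = mat_inv B *\<^sub>v (Z_mat A B S *\<^sub>v (x - xs))"
  unfolding grad_sketch_def residual[OF x] Z_mat_def
  using A H_mat_carrier[OF S] Bi x xs by (simp add: assoc_mult_mat_vec_dim)

abbreviation "EZ \<equiv> EZ_mat n D A B"

lemma integrable_Z:
  assumes ij: "i < n" "j < n"
  shows "integrable D (\<lambda>S. Z_mat A B S $$ (i, j))"
proof (rule prob_space.bounded_measurable_integrable[OF D])
  have "space D = space (mat_borel m)" by (rule sets_eq_imp_space_eq[OF sets_D])
  then show "bounded_measurable D (\<lambda>S. Z_mat A B S $$ (i, j))"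
    using bounded_measurable_Z[OF ij] unfolding bounded_measurable_def measurable_cong_sets[OF
        sets_D refl]
    by simp
qed

lemma EZ: "EZ \<in> carrier_mat n n" "transpose_mat EZ = EZ"
proof -
  show "EZ \<in> carrier_mat n n" by (simp add: EZ_mat_def)
  have "Z_mat A B S $$ (j, i) = Z_mat A B S $$ (i, j)" if "S \<in> space D" "i < n" "j < n" for S i j
  proof -
    have S: "dim_row S = m" using that by (simp add: space_D)
    have "transpose_mat (Z_mat A B S) $$ (i, j) = Z_mat A B S $$ (j, i)" using that Z_mat(1)[OF S]
        by simp
    then show ?thesis unfolding Z_mat(2)[OF S] by simp
  qed
  then show "transpose_mat EZ = EZ"
    by (intro eq_matI) (auto simp: EZ_mat_def intro!: Bochner_Integration.integral_cong)
qed

lemma EZ_form: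
  assumes v: "v \<in> carrier_vec n"
  shows "ip_B EZ v v = (\<integral>S. ip_B (Z_mat A B S) v v \<partial>D)"
proof -
  have "(\<integral>S. ip_B (Z_mat A B S) v v \<partial>D) = (\<integral>S. (\<Sum>i<n. \<Sum>j<n. Z_mat A B S $$ (i, j) * (v $ i * v $
      j)) \<partial>D)"
    by (rule Bochner_Integration.integral_cong[OF refl], rule ip_B_entries[OF Z_mat(1) v v]) (simp
        add: space_D)
  also have "\<dots> = (\<Sum>i<n. \<Sum>j<n. (\<integral>S. Z_mat A B S $$ (i, j) \<partial>D) * (v $ i * v $ j))"
  proof -
    have int: "integrable D (\<lambda>S. Z_mat A B S $$ (i, j) * (v $ i * v $ j))" if "i < n" "j < n" for
        i j
      by (rule integrable_mult_left) (rule integrable_Z[OF that])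
    have "(\<integral>S. (\<Sum>i<n. \<Sum>j<n. Z_mat A B S $$ (i, j) * (v $ i * v $ j)) \<partial>D)
      = (\<Sum>i<n. \<Sum>j<n. (\<integral>S. Z_mat A B S $$ (i, j) * (v $ i * v $ j) \<partial>D))"
      by (subst Bochner_Integration.integral_sum, intro Bochner_Integration.integrable_sum int;
          simp)
        (intro sum.cong refl, subst Bochner_Integration.integral_sum, rule int; simp)
    then show ?thesis by simp
  qed
  also have "\<dots> = ip_B EZ v v"
    unfolding ip_B_entries[OF EZ(1) v v] by (simp add: EZ_mat_def)
  finally show ?thesis ..
qed

lemma EZ_nonneg: "v \<in> carrier_vec n \<Longrightarrow> ip_B EZ v v \<ge> 0"
  unfolding EZ_form by (rule integral_nonneg_AE) (auto intro!: AE_I2 Z_mat simp: space_D)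

lemma f_full_eq:
  assumes x: "x \<in> carrier_vec n"
  shows "f_full D A B b x = ip_B EZ (x - xs) (x - xs) / 2"
proof -
  have "f_full D A B b x = (\<integral>S. ip_B (Z_mat A B S) (x - xs) (x - xs) / 2 \<partial>D)"
    unfolding f_full_def
    by (rule Bochner_Integration.integral_cong[OF refl]) (simp add: space_D f_sketch_eq x)
  then show ?thesis using EZ_form[of "x - xs"] x xs by simp
qed

text \<open>Where the quadratic form of \<open>E[Z]\<close> vanishes, \<open>xs + y\<close> attains the minimal value \<open>0\<close> of \<open>f\<close>, so it solves
the system.\<close>

lemma exactness_kernel:
  assumes ex: "exactness n D A B b" and y: "y \<in> carrier_vec n" and z: "ip_B EZ y y = 0"
  shows "A *\<^sub>v y = 0\<^sub>v m"
proof -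
  have xy: "xs + y \<in> carrier_vec n" using xs y by simp
  have "xs + y - xs = y" using xs y by (intro eq_vecI) auto
  then have "f_full D A B b (xs + y) = 0" using f_full_eq[OF xy] z by simp
  moreover have "f_full D A B b x \<ge> 0" if "x \<in> carrier_vec n" for x
    using f_full_eq[OF that] EZ_nonneg[of "x - xs"] that xs by simp
  ultimately have "xs + y \<in> sol_set n A b" using ex xy unfolding exactness_def by auto
  then have "A *\<^sub>v (xs + y) = b" by (simp add: sol_set_def)
  then have "A *\<^sub>v xs + A *\<^sub>v y = A *\<^sub>v xs"
    using mult_add_distrib_mat_vec[OF A xs(1) y] xs(2) by simp
  then show ?thesis using A by (intro eq_vecI) (auto simp: vec_eq_iff)
qed

lemma R: "spd_sqrt n B \<in> carrier_mat n n" "transpose_mat (spd_sqrt n B) = spd_sqrt n B"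
  and Ri: "mat_inv (spd_sqrt n B) \<in> carrier_mat n n" "transpose_mat (mat_inv (spd_sqrt n B)) =
      mat_inv (spd_sqrt n B)"
  using spd_sqrt(1)[OF spd] spd_mat_inv(1)[OF spd_sqrt(1)[OF spd]] by (auto simp: spd_mat_def)

abbreviation "W \<equiv> W_mat n D A B"

lemma W: "W \<in> carrier_mat n n" "transpose_mat W = W"
  using EZ Ri by (auto simp: W_mat_def transpose_mult_dim assoc_mult_mat_dim)

text \<open>With \<open>R = spd_sqrt n B\<close>, the substitution \<open>u = R d\<close> turns the form of \<open>E[Z]\<close> relative to the \<open>B\<close>-norm into the form of \<open>W\<close>
relative to the Euclidean norm.\<close>

lemma W_form:
  assumes u: "u \<in> carrier_vec n"
  shows "ip_B W u u = ip_B EZ (mat_inv (spd_sqrt n B) *\<^sub>v u) (mat_inv (spd_sqrt n B) *\<^sub>v u)"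
  unfolding ip_B_def W_mat_def
  using transpose_adjoint_dim[of u "mat_inv (spd_sqrt n B)"] EZ Ri u by (simp add:
      assoc_mult_mat_vec_dim)

lemma R_vec:
  assumes u: "u \<in> carrier_vec n"
  shows "mat_inv (spd_sqrt n B) *\<^sub>v (spd_sqrt n B *\<^sub>v u) = u" "spd_sqrt n B *\<^sub>v (mat_inv (spd_sqrt n
      B) *\<^sub>v u) = u"
    "spd_sqrt n B *\<^sub>v (spd_sqrt n B *\<^sub>v u) = B *\<^sub>v u"
  using spd_mat_inv(2,3)[OF spd_sqrt(1)[OF spd]] spd_sqrt(2)[OF spd] R Ri u
  by (metis assoc_mult_mat_vec one_mult_mat_vec)+

lemma norm_via_sqrt:
  assumes d: "d \<in> carrier_vec n"
  shows "ip_B B d d = (spd_sqrt n B *\<^sub>v d) \<bullet> (spd_sqrt n B *\<^sub>v d)"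
  unfolding ip_B_def R_vec(3)[OF d, symmetric]
  using transpose_adjoint_dim[of d "spd_sqrt n B" "spd_sqrt n B *\<^sub>v d"] R d by simp

lemma EZ_upper:
  assumes d: "d \<in> carrier_vec n"
  shows "ip_B EZ d d \<le> lambda_max W * ip_B B d d"
proof -
  have u: "spd_sqrt n B *\<^sub>v d \<in> carrier_vec n" using R d by simp
  show ?thesis using symmetric_rayleigh(1)[OF W u] W_form[OF u] R_vec(1)[OF d] norm_via_sqrt[OF d]
      by simp
qed

lemma lambda_max_W_nonneg: "W \<noteq> 0\<^sub>m n n \<Longrightarrow> lambda_max W \<ge> 0"
proof (rule lambda_max_nonneg[OF W])
  assume "W \<noteq> 0\<^sub>m n n"
  then show "n > 0" using W by (cases n) (auto intro!: eq_matI)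
  show "ip_B W u u \<ge> 0" if "u \<in> carrier_vec n" for u
    unfolding W_form[OF that] using Ri that by (intro EZ_nonneg) simp
qed

definition kernel_orthogonal :: "real vec set" where
  "kernel_orthogonal = {d \<in> carrier_vec n. \<forall>y \<in> carrier_vec n. A *\<^sub>v y = 0\<^sub>v m \<longrightarrow> ip_B B d y = 0}"

text \<open>Let \<open>R = spd_sqrt n B\<close>. If \<open>W w = 0\<close>, then by exactness \<open>y = R\<inverse> w\<close> lies in the kernel of \<open>A\<close>, and
\<open>w\<^sup>T R d = y\<^sup>T B d = 0\<close>. So \<open>R d\<close> has no component on which \<open>W\<close> vanishes.\<close>

lemma EZ_lower:
  assumes ex: "exactness n D A B b" and d: "d \<in> kernel_orthogonal"
  shows "lambda_min_plus W * ip_B B d d \<le> ip_B EZ d d"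
proof -
  have dc: "d \<in> carrier_vec n" using d by (simp add: kernel_orthogonal_def)
  let ?u = "spd_sqrt n B *\<^sub>v d"
  have u: "?u \<in> carrier_vec n" using R dc by simp
  have "w \<bullet> ?u = 0" if w: "w \<in> carrier_vec n" "W *\<^sub>v w = 0\<^sub>v n" for w
  proof -
    let ?y = "mat_inv (spd_sqrt n B) *\<^sub>v w"
    have y: "?y \<in> carrier_vec n" using Ri w by simp
    have "ip_B EZ ?y ?y = 0" using W_form[OF w(1)] w by (simp add: ip_B_def)
    then have "A *\<^sub>v ?y = 0\<^sub>v m" by (rule exactness_kernel[OF ex y])
    then have "ip_B B d ?y = 0" using d y by (simp add: kernel_orthogonal_def)
    also have "ip_B B d ?y = d \<bullet> (spd_sqrt n B *\<^sub>v w)"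
      unfolding ip_B_def R_vec(3)[OF y, symmetric] R_vec(2)[OF w(1)] ..
    also have "\<dots> = ?u \<bullet> w" using transpose_adjoint_dim[of d "spd_sqrt n B" w] R dc w by simp
    finally show ?thesis using comm_scalar_prod[OF w(1) u] by simp
  qed
  from symmetric_rayleigh(2)[OF W u this] show ?thesis
    using W_form[OF u] R_vec(1)[OF dc] norm_via_sqrt[OF dc] by simp
qed

end

section \<open>Projection onto the solution set\<close>

text \<open>The minimizer is explicit: with \<open>Z\<close> formed from \<open>G = A\<close>, the point \<open>x - B\<inverse> Z (x - y)\<close> solves the system,
and its difference to \<open>x\<close> is \<open>B\<close>-orthogonal to the kernel of \<open>A\<close>. By Pythagoras no other solution is as
close to \<open>x\<close>.\<close>

lemma (in sketching) proj_sol_set: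
  assumes y: "y \<in> sol_set n A b" and x: "x \<in> carrier_vec n"
  defines "p \<equiv> proj_B B (sol_set n A b) x"
  shows "p \<in> sol_set n A b"
    and "\<And>z. z \<in> carrier_vec n \<Longrightarrow> A *\<^sub>v z = 0\<^sub>v m \<Longrightarrow> ip_B B (x - p) z = 0"
proof -
  interpret weighted_row_projection n m B A by unfold_locales (rule spd, rule A)
  let ?L = "sol_set n A b"
  define w where "w = x - y"
  define r where "r = Bi *\<^sub>v (Z *\<^sub>v w)"
  define p0 where "p0 = x - r"
  have yc: "y \<in> carrier_vec n" "A *\<^sub>v y = b" using y by (auto simp: sol_set_def)
  have w: "w \<in> carrier_vec n" using x yc by (simp add: w_def)
  have r: "r \<in> carrier_vec n" using Bi Z w by (simp add: r_def)
  have p0: "p0 \<in> carrier_vec n" using x r by (simp add: p0_def)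
  have xp0: "x - p0 = r" using x r by (intro eq_vecI) (auto simp: p0_def)
  have "A *\<^sub>v p0 = A *\<^sub>v x - A *\<^sub>v w"
    unfolding p0_def mult_minus_distrib_mat_vec[OF A x r] using G_Bi_Z[OF w] by (simp add: r_def)
  also have "\<dots> = b"
    unfolding w_def mult_minus_distrib_mat_vec[OF A x yc(1)] yc(2)
    using A yc by (intro eq_vecI) auto
  finally have p0L: "p0 \<in> ?L" using p0 by (simp add: sol_set_def)
  have orth: "ip_B B r z = 0" if "z \<in> carrier_vec n" "A *\<^sub>v z = 0\<^sub>v m" for z
    unfolding r_def ip_B_BiZ[OF w that(1)] using Z_kernel[OF that] w by (simp add: ip_B_def)
  have pyth: "ip_B B (z - x) (z - x) = ip_B B (z - p0) (z - p0) + ip_B B r r" if z: "z \<in> ?L" for z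
  proof -
    have zc: "z \<in> carrier_vec n" "A *\<^sub>v z = b" using z by (auto simp: sol_set_def)
    have zp: "z - p0 \<in> carrier_vec n" using zc p0 by simp
    have "A *\<^sub>v (z - p0) = 0\<^sub>v m"
      unfolding mult_minus_distrib_mat_vec[OF A zc(1) p0] using zc p0L A by (auto simp:
          sol_set_def intro!: eq_vecI)
    then have o: "ip_B B r (z - p0) = 0" by (rule orth[OF zp])
    have "z - x = (z - p0) - r" using zc x r by (intro eq_vecI) (auto simp: p0_def)
    then have "ip_B B (z - x) (z - x) = ip_B B ((z - p0) - r) ((z - p0) - r)" by simp
    also have "\<dots> = ip_B B (z - p0) (z - p0) - 2 * ip_B B r (z - p0) + ip_B B r r"
      unfolding ip_B_minus_left[OF B(1) zp r minus_carrier_vec[OF zp r]]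
        ip_B_minus_right[OF B(1) zp r zp] ip_B_minus_right[OF B(1) zp r r] ip_B_sym[OF B zp r]
      by simp
    finally show ?thesis using o by simp
  qed
  let ?f = "\<lambda>z. norm_B B (z - x)"
  have p0min: "\<not> ?f z < ?f p0" if z: "z \<in> ?L" for z
  proof -
    have "z - p0 \<in> carrier_vec n" using z p0 by (auto simp: sol_set_def)
    then have "ip_B B r r \<le> ip_B B (z - x) (z - x)" unfolding pyth[OF z] using spd_ip_nonneg[OF
        spd] by simp
    moreover have "ip_B B (p0 - p0) (p0 - p0) = 0" using p0 B by (simp add: ip_B_def)
    ultimately show ?thesis unfolding norm_B_def using pyth[OF p0L] by simp
  qed
  have "is_arg_min ?f (\<lambda>z. z \<in> ?L) p"
    unfolding p_def proj_B_def arg_min_on_def arg_min_def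
    by (rule someI[of _ p0]) (use p0L p0min in \<open>auto simp: is_arg_min_def\<close>)
  then have pL: "p \<in> ?L" and pmin: "\<not> ?f p0 < ?f p" using p0L by (auto simp: is_arg_min_def)
  have pc: "p - p0 \<in> carrier_vec n" using pL p0 by (auto simp: sol_set_def)
  have "ip_B B (p - x) (p - x) \<le> ip_B B (p0 - x) (p0 - x)" using pmin by (simp add: norm_B_def)
  moreover have "ip_B B (p0 - p0) (p0 - p0) = 0" using p0 B by (simp add: ip_B_def)
  ultimately have "ip_B B (p - p0) (p - p0) \<le> 0" unfolding pyth[OF pL] pyth[OF p0L] by simp
  then have "p - p0 = 0\<^sub>v n" using spd_ip_nonneg[OF spd pc] spd_ip_zero_iff[OF spd pc] by simp
  then have "p = p0" using pL p0 by (intro eq_vecI) (auto simp: vec_eq_iff sol_set_def)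
  then show "p \<in> ?L" "\<And>z. z \<in> carrier_vec n \<Longrightarrow> A *\<^sub>v z = 0\<^sub>v m \<Longrightarrow> ip_B B (x - p) z = 0"
    using p0L orth xp0 by auto
qed

section \<open>Sample paths of the iteration\<close>

locale momentum_run = sketching_method +
  fixes \<omega> \<beta> :: real and x0 :: "real vec"
  assumes x0: "x0 \<in> carrier_vec n" "x0 - xs \<in> kernel_orthogonal"
    and \<omega>: "0 < \<omega>" "\<omega> < 2" and \<beta>: "\<beta> \<ge> 0"
begin

definition err :: "(nat \<Rightarrow> real mat) \<Rightarrow> nat \<Rightarrow> real vec" where
  "err s k = msgd A B b \<omega> \<beta> x0 x0 s k - xs"

lemma msgd_carrier: "msgd A B b \<omega> \<beta> x0 x0 s k \<in> carrier_vec n"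
proof (induction k rule: induct_nat_012)
  case (ge2 k)
  have "grad_sketch A B b S y \<in> carrier_vec n" for S y
    using Bi by (auto simp: grad_sketch_def intro!: carrier_vecI)
  then show ?case using ge2 by simp
qed (use x0 in auto)

lemma err_carrier [simp]: "err s k \<in> carrier_vec n"
  using msgd_carrier xs by (simp add: err_def)

lemma err_0: "err s 0 = x0 - xs" and err_1: "err s (Suc 0) = x0 - xs"
  by (simp_all add: err_def)

lemma err_Suc_Suc:
  assumes "dim_row (s (Suc k)) = m"
  shows "err s (Suc (Suc k)) = err s (Suc k) - \<omega> \<cdot>\<^sub>v (mat_inv B *\<^sub>v (Z_mat A B (s (Suc k)) *\<^sub>v err s
      (Suc k)))
    + \<beta> \<cdot>\<^sub>v (err s (Suc k) - err s k)"
proof -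
  let ?y = "msgd A B b \<omega> \<beta> x0 x0 s (Suc k)"
  let ?g = "mat_inv B *\<^sub>v (Z_mat A B (s (Suc k)) *\<^sub>v (?y - xs))"
  have g: "?g \<in> carrier_vec n" using Bi by (auto intro: carrier_vecI)
  have shift: "(y - \<omega> \<cdot>\<^sub>v g + \<beta> \<cdot>\<^sub>v (y - z)) - xs = (y - xs) - \<omega> \<cdot>\<^sub>v g + \<beta> \<cdot>\<^sub>v ((y - xs) - (z - xs))"
    if "y \<in> carrier_vec n" "z \<in> carrier_vec n" "g \<in> carrier_vec n" for y z g
    using that xs(1) by (intro eq_vecI) (auto simp: algebra_simps)
  show ?thesis
    unfolding err_def msgd.simps(3) grad_sketch_eq[OF assms msgd_carrier]
    by (rule shift[OF msgd_carrier msgd_carrier g])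
qed

text \<open>The correction \<open>B\<inverse> Z d\<close> pairs with \<open>y\<close> to \<open>d\<^sup>T Z y\<close>, which vanishes when \<open>A y = 0\<close>.\<close>

lemma err_kernel_orthogonal:
  assumes s: "\<And>i. i \<ge> 1 \<Longrightarrow> dim_row (s i) = m"
  shows "err s k \<in> kernel_orthogonal"
proof (induction k rule: induct_nat_012)
  case (ge2 k)
  let ?d = "err s (Suc k)" and ?e = "err s k" and ?Z = "Z_mat A B (s (Suc k))"
  have sk: "dim_row (s (Suc k)) = m" using s by simp
  let ?g = "mat_inv B *\<^sub>v (?Z *\<^sub>v ?d)"
  have g: "?g \<in> carrier_vec n" using Bi by (auto intro: carrier_vecI)
  have "ip_B B (err s (Suc (Suc k))) y = 0" if y: "y \<in> carrier_vec n" "A *\<^sub>v y = 0\<^sub>v m" for y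
  proof -
    have "ip_B B ?g y = 0"
    proof -
      interpret weighted_row_projection n "dim_col (s (Suc k))" B "transpose_mat (s (Suc k)) * A"
        by (rule sketch_projection[OF sk])
      have "ip_B B ?g y = ip_B ?Z ?d y" unfolding Z_mat_eq[OF sk] by (rule ip_B_BiZ) (use y in auto)
      then show ?thesis using Z_mat(4)[OF sk y] by (simp add: ip_B_def)
    qed
    moreover have "ip_B B ?d y = 0" "ip_B B ?e y = 0" using ge2 y by (auto simp:
        kernel_orthogonal_def)
    ultimately show ?thesis
      unfolding err_Suc_Suc[of s k, OF sk] using g y B by (simp add: ip_B_bilinear)
  qed
  then show ?case by (simp add: kernel_orthogonal_def)
qed (use x0 in \<open>auto simp: err_0 err_1\<close>)

text \<open>The \<open>k\<close>-th iterate has used only the sketches with indices \<open>1, \<dots>, k - 1\<close>. This is what makes it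
independent of the sketch drawn at time \<open>k\<close>.\<close>

lemma err_cong:
  assumes "\<And>i. 1 \<le> i \<Longrightarrow> i < k \<Longrightarrow> s i = t i"
  shows "err s k = err t k"
proof -
  have "msgd A B b \<omega> \<beta> x0 x0 s k = msgd A B b \<omega> \<beta> x0 x0 t k"
    using assms
  proof (induction k rule: induct_nat_012)
    case (ge2 k)
    have "msgd A B b \<omega> \<beta> x0 x0 s k = msgd A B b \<omega> \<beta> x0 x0 t k"
      "msgd A B b \<omega> \<beta> x0 x0 s (Suc k) = msgd A B b \<omega> \<beta> x0 x0 t (Suc k)"
      "s (Suc k) = t (Suc k)"
      by (rule ge2.IH, simp add: ge2.prems, rule ge2.IH, simp add: ge2.prems, simp add: ge2.prems)
    then show ?case by simp
  qed auto
  then show ?thesis by (simp add: err_def)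
qed

lemma err_step:
  assumes "dim_row (s (Suc k)) = m"
  shows "ip_B B (err s (Suc (Suc k))) (err s (Suc (Suc k)))
    \<le> (1 + 3 * \<beta> + 2 * \<beta>\<^sup>2) * ip_B B (err s (Suc k)) (err s (Suc k))
    + (\<beta> + 2 * \<beta>\<^sup>2) * ip_B B (err s k) (err s k)
    - (\<omega> * (2 - \<omega>) + \<omega> * \<beta>) * ip_B (Z_mat A B (s (Suc k))) (err s (Suc k)) (err s (Suc k))
    + \<omega> * \<beta> * ip_B (Z_mat A B (s (Suc k))) (err s k) (err s k)"
proof -
  interpret weighted_row_projection n "dim_col (s (Suc k))" B "transpose_mat (s (Suc k)) * A"
    by (rule sketch_projection[OF assms])
  show ?thesis
    unfolding err_Suc_Suc[of s k, OF assms] Z_mat_eq[OF assms]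
    by (rule momentum_step[OF err_carrier err_carrier \<beta>]) (use \<omega> in simp)
qed

text \<open>Formulated for an arbitrary measure \<open>M\<close>, since it is applied both to the underlying probability space
and to finite products of the sketch space.\<close>

lemma bounded_measurable_err:
  assumes "\<And>i. 1 \<le> i \<Longrightarrow> i < k \<Longrightarrow> S i \<in> measurable M (mat_borel m)" and "j < n"
  shows "bounded_measurable M (\<lambda>w. err (\<lambda>i. S i w) k $ j)"
  using assms
proof (induction k arbitrary: j rule: induct_nat_012)
  case (ge2 k)
  let ?d = "\<lambda>w. err (\<lambda>i. S i w) (Suc k)" and ?e = "\<lambda>w. err (\<lambda>i. S i w) k"
  let ?Z = "\<lambda>w. Z_mat A B (S (Suc k) w)"
  have Sk: "S (Suc k) \<in> measurable M (mat_borel m)" using ge2.prems by simp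
  have d: "bounded_measurable M (\<lambda>w. ?d w $ l)" and e: "bounded_measurable M (\<lambda>w. ?e w $ l)" if "l
      < n" for l
    by (rule ge2.IH, simp add: ge2.prems, rule that, rule ge2.IH, simp add: ge2.prems, rule that)
  have Z: "bounded_measurable M (\<lambda>w. ?Z w $$ (p, l))" if "p < n" "l < n" for p l
    by (rule bounded_measurable_compose[OF bounded_measurable_Z[OF that] Sk])
  have mv: "(N *\<^sub>v v) $ p = (\<Sum>l<n. N $$ (p, l) * v $ l)"
    if "N \<in> carrier_mat n n" "v \<in> carrier_vec n" "p < n" for N :: "real mat" and v p
    using that by (auto simp: scalar_prod_def atLeast0LessThan intro!: sum.cong)
  have idx: "(v - \<omega> \<cdot>\<^sub>v g + \<beta> \<cdot>\<^sub>v (v - z)) $ p = v $ p - \<omega> * g $ p + \<beta> * (v $ p - z $ p)"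
    if "v \<in> carrier_vec n" "z \<in> carrier_vec n" "g \<in> carrier_vec n" "p < n" for v z g :: "real vec"
        and p
    using that by simp
  show ?case
  proof (rule bounded_measurable_cong)
    fix w assume w: "w \<in> space M"
    then have row: "dim_row (S (Suc k) w) = m"
      using measurable_space[OF Sk] by (simp add: space_mat_borel)
    have Zc: "?Z w \<in> carrier_mat n n" by (rule Z_mat(1)[OF row])
    have Zd: "?Z w *\<^sub>v ?d w \<in> carrier_vec n" using Zc by simp
    have "(mat_inv B *\<^sub>v (?Z w *\<^sub>v ?d w)) $ j
      = (\<Sum>l<n. mat_inv B $$ (j, l) * (\<Sum>p<n. ?Z w $$ (l, p) * ?d w $ p))"
      unfolding mv[OF Bi(1) Zd ge2.prems(2)] by (intro sum.cong refl) (simp add: mv[OF Zc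
          err_carrier])
    moreover have "err (\<lambda>i. S i w) (Suc (Suc k)) $ j
      = ?d w $ j - \<omega> * (mat_inv B *\<^sub>v (?Z w *\<^sub>v ?d w)) $ j + \<beta> * (?d w $ j - ?e w $ j)"
      unfolding err_Suc_Suc[of "\<lambda>i. S i w" k, OF row]
      by (rule idx[OF err_carrier err_carrier mult_mat_vec_carrier[OF Bi(1) Zd] ge2.prems(2)])
    ultimately show "err (\<lambda>i. S i w) (Suc (Suc k)) $ j
      = ?d w $ j - \<omega> * (\<Sum>l<n. mat_inv B $$ (j, l) * (\<Sum>p<n. ?Z w $$ (l, p) * ?d w $ p))
        + \<beta> * (?d w $ j - ?e w $ j)" by simp
  next
    show "bounded_measurable M (\<lambda>w. ?d w $ j - \<omega> * (\<Sum>l<n. mat_inv B $$ (j, l) * (\<Sum>p<n. ?Z w $$ (l,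
        p) * ?d w $ p))
        + \<beta> * (?d w $ j - ?e w $ j))"
      using ge2.prems(2) by (intro bounded_measurable_intros d e Z) auto
  qed
qed (auto simp: err_0 err_1 intro: bounded_measurable_const)

end

section \<open>Random iterates\<close>

locale random_momentum_run = momentum_run +
  fixes P :: "'w measure" and S :: "nat \<Rightarrow> 'w \<Rightarrow> real mat"
  assumes P: "prob_space P"
    and indep: "prob_space.indep_vars P (\<lambda>_. mat_borel m) S {1..}"
    and distr: "\<And>k. k \<ge> 1 \<Longrightarrow> distr P (mat_borel m) (S k) = D"
begin

sublocale P: prob_space P by (rule P)

abbreviation "E w k \<equiv> err (\<lambda>i. S i w) k"

lemma S_measurable: "k \<ge> 1 \<Longrightarrow> S k \<in> measurable P (mat_borel m)"
  using indep unfolding P.indep_vars_def by auto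

lemma S_row: "k \<ge> 1 \<Longrightarrow> w \<in> space P \<Longrightarrow> dim_row (S k w) = m"
  using measurable_space[OF S_measurable] by (simp add: space_mat_borel)

lemma bounded_measurable_E: "j < n \<Longrightarrow> bounded_measurable P (\<lambda>w. E w k $ j)"
  by (rule bounded_measurable_err) (use S_measurable in auto)

lemma bounded_measurable_E_form: "N \<in> carrier_mat n n \<Longrightarrow> bounded_measurable P (\<lambda>w. ip_B N (E w k)
    (E w k))"
  by (rule bounded_measurable_ip) (use bounded_measurable_E in auto)

lemma bounded_measurable_Z_S:
  "k \<ge> 1 \<Longrightarrow> i < n \<Longrightarrow> l < n \<Longrightarrow> bounded_measurable P (\<lambda>w. Z_mat A B (S k w) $$ (i, l))"
  using bounded_measurable_compose[OF bounded_measurable_Z S_measurable] .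

lemma Z_form_eq:
  assumes "k \<ge> 1" "w \<in> space P"
  shows "ip_B (Z_mat A B (S k w)) (E w j) (E w j)
    = (\<Sum>i<n. \<Sum>l<n. Z_mat A B (S k w) $$ (i, l) * (E w j $ i * E w j $ l))"
  by (rule ip_B_entries[OF Z_mat(1)[OF S_row[OF assms]] err_carrier err_carrier])

lemma bounded_measurable_Z_form:
  assumes k: "k \<ge> 1"
  shows "bounded_measurable P (\<lambda>w. ip_B (Z_mat A B (S k w)) (E w j) (E w j))"
proof (rule bounded_measurable_cong[OF Z_form_eq[OF k]])
  show "bounded_measurable P (\<lambda>w. \<Sum>i<n. \<Sum>l<n. Z_mat A B (S k w) $$ (i, l) * (E w j $ i * E w j $
      l))"
    by (intro bounded_measurable_intros bounded_measurable_E bounded_measurable_Z_S k) auto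
qed

text \<open>The form is a finite sum of products of an entry of \<open>Z\<close>, a function of the sketch number \<open>k\<close>, with a
product of two coordinates of the error, a function of earlier sketches. By independence each
expectation factorizes, which avoids conditional expectations.\<close>

lemma expected_Z_form:
  assumes k: "k \<ge> 1" and jk: "j \<le> k"
  shows "(\<integral>w. ip_B (Z_mat A B (S k w)) (E w j) (E w j) \<partial>P) = (\<integral>w. ip_B EZ (E w j) (E w j) \<partial>P)"
proof -
  have entry: "(\<integral>w. Z_mat A B (S k w) $$ (i, l) * (E w j $ i * E w j $ l) \<partial>P)
    = EZ $$ (i, l) * (\<integral>w. E w j $ i * E w j $ l \<partial>P)" if i: "i < n" and l: "l < n" for i l
  proof -
    let ?M = "\<lambda>J. PiM J (\<lambda>_. mat_borel m)"
    let ?Y1 = "\<lambda>s. Z_mat A B (s k) $$ (i, l)"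
    let ?Y2 = "\<lambda>s. err s j $ i * err s j $ l"
    have "P.indep_var (?M {k}) (\<lambda>w. restrict (\<lambda>i. S i w) {k}) (?M {1..<j}) (\<lambda>w. restrict (\<lambda>i. S i
        w) {1..<j})"
      by (rule P.indep_var_restrict[OF indep]) (use k jk in auto)
    moreover have "?Y1 \<in> borel_measurable (?M {k})"
      by (rule measurable_compose[where f = "\<lambda>s. s k", OF _ measurable_Z_entry[OF i l]])
        (rule measurable_component_singleton, simp)
    moreover have "?Y2 \<in> borel_measurable (?M {1..<j})"
    proof -
      have "bounded_measurable (?M {1..<j}) (\<lambda>s. err (\<lambda>i. s i) j $ p)" if "p < n" for p
        by (rule bounded_measurable_err) (use that in \<open>auto intro!: measurable_component_singleton\<close>)
      then have "bounded_measurable (?M {1..<j}) ?Y2" using i l by (intro bounded_measurable_mult)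
          auto
      then show ?thesis by (simp add: bounded_measurable_def)
    qed
    ultimately have "P.indep_var borel (?Y1 \<circ> (\<lambda>w. restrict (\<lambda>i. S i w) {k})) borel (?Y2 \<circ> (\<lambda>w.
        restrict (\<lambda>i. S i w) {1..<j}))"
      by (rule P.indep_var_compose)
    moreover have "?Y1 \<circ> (\<lambda>w. restrict (\<lambda>i. S i w) {k}) = (\<lambda>w. Z_mat A B (S k w) $$ (i, l))" by auto
    moreover have "err (restrict (\<lambda>i. S i w) {1..<j}) j = E w j" for w by (rule err_cong) auto
    then have "?Y2 \<circ> (\<lambda>w. restrict (\<lambda>i. S i w) {1..<j}) = (\<lambda>w. E w j $ i * E w j $ l)" by auto
    ultimately have ind: "P.indep_var borel (\<lambda>w. Z_mat A B (S k w) $$ (i, l)) borel (\<lambda>w. E w j $ i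
        * E w j $ l)" by simp
    have "(\<integral>w. Z_mat A B (S k w) $$ (i, l) * (E w j $ i * E w j $ l) \<partial>P)
      = (\<integral>w. Z_mat A B (S k w) $$ (i, l) \<partial>P) * (\<integral>w. E w j $ i * E w j $ l \<partial>P)"
      by (rule P.indep_var_lebesgue_integral[OF ind])
        (intro P.bounded_measurable_integrable bounded_measurable_intros bounded_measurable_E
            bounded_measurable_Z_S k i l)+
    also have "(\<integral>w. Z_mat A B (S k w) $$ (i, l) \<partial>P) = EZ $$ (i, l)"
      using integral_distr[OF S_measurable[OF k] measurable_Z_entry[OF i l]] distr[OF k] i l
      by (simp add: EZ_mat_def)
    finally show ?thesis .
  qed
  have int: "integrable P (\<lambda>w. Z_mat A B (S k w) $$ (i, l) * (E w j $ i * E w j $ l))"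
    "integrable P (\<lambda>w. EZ $$ (i, l) * (E w j $ i * E w j $ l))" if "i < n" "l < n" for i l
    by (intro P.bounded_measurable_integrable bounded_measurable_intros bounded_measurable_E
        bounded_measurable_Z_S k that)+
  have sum2: "(\<integral>w. (\<Sum>i<n. \<Sum>l<n. g i l w) \<partial>P) = (\<Sum>i<n. \<Sum>l<n. \<integral>w. g i l w \<partial>P)"
    if g: "\<And>i l. i < n \<Longrightarrow> l < n \<Longrightarrow> integrable P (g i l)" for g :: "nat \<Rightarrow> nat \<Rightarrow> 'w \<Rightarrow> real"
  proof -
    have "integrable P (\<lambda>w. \<Sum>l<n. g i l w)" if "i < n" for i
      by (rule Bochner_Integration.integrable_sum) (use g that in simp)
    then have "(\<integral>w. (\<Sum>i<n. \<Sum>l<n. g i l w) \<partial>P) = (\<Sum>i<n. \<integral>w. (\<Sum>l<n. g i l w) \<partial>P)"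
      by (intro Bochner_Integration.integral_sum) simp
    also have "\<dots> = (\<Sum>i<n. \<Sum>l<n. \<integral>w. g i l w \<partial>P)"
      by (intro sum.cong refl Bochner_Integration.integral_sum) (use g in simp)
    finally show ?thesis .
  qed
  have "(\<integral>w. ip_B (Z_mat A B (S k w)) (E w j) (E w j) \<partial>P)
    = (\<integral>w. (\<Sum>i<n. \<Sum>l<n. Z_mat A B (S k w) $$ (i, l) * (E w j $ i * E w j $ l)) \<partial>P)"
    by (rule Bochner_Integration.integral_cong[OF refl Z_form_eq[OF k]])
  also have "\<dots> = (\<Sum>i<n. \<Sum>l<n. \<integral>w. Z_mat A B (S k w) $$ (i, l) * (E w j $ i * E w j $ l) \<partial>P)"
    by (rule sum2[OF int(1)])
  also have "\<dots> = (\<Sum>i<n. \<Sum>l<n. \<integral>w. EZ $$ (i, l) * (E w j $ i * E w j $ l) \<partial>P)"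
    by (intro sum.cong refl) (simp add: entry)
  also have "\<dots> = (\<integral>w. (\<Sum>i<n. \<Sum>l<n. EZ $$ (i, l) * (E w j $ i * E w j $ l)) \<partial>P)"
    by (rule sum2[OF int(2), symmetric])
  also have "\<dots> = (\<integral>w. ip_B EZ (E w j) (E w j) \<partial>P)"
    unfolding ip_B_entries[OF EZ(1) err_carrier err_carrier] ..
  finally show ?thesis .
qed

definition second_moment :: "nat \<Rightarrow> real" where
  "second_moment k = (\<integral>w. ip_B B (E w k) (E w k) \<partial>P)"

lemmas integrable_forms = P.bounded_measurable_integrable[OF bounded_measurable_E_form]
  P.bounded_measurable_integrable[OF bounded_measurable_Z_form]

lemma second_moment_nonneg: "second_moment k \<ge> 0"
  unfolding second_moment_def by (rule integral_nonneg_AE) (auto intro!: AE_I2 spd_ip_nonneg[OF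
      spd])

lemma second_moment_start: "second_moment 0 = ip_B B (x0 - xs) (x0 - xs)" "second_moment 1 =
    second_moment 0"
  unfolding second_moment_def by (simp_all add: err_0 err_1 P.prob_space)

lemma expected_EZ_upper: "(\<integral>w. ip_B EZ (E w k) (E w k) \<partial>P) \<le> lambda_max W * second_moment k"
proof -
  have "(\<integral>w. ip_B EZ (E w k) (E w k) \<partial>P) \<le> (\<integral>w. lambda_max W * ip_B B (E w k) (E w k) \<partial>P)"
    by (intro integral_mono integrable_mult_right integrable_forms EZ B EZ_upper err_carrier)
  then show ?thesis by (simp add: second_moment_def)
qed

lemma expected_EZ_lower:
  assumes ex: "exactness n D A B b"
  shows "lambda_min_plus W * second_moment k \<le> (\<integral>w. ip_B EZ (E w k) (E w k) \<partial>P)"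
proof -
  have "(\<integral>w. lambda_min_plus W * ip_B B (E w k) (E w k) \<partial>P) \<le> (\<integral>w. ip_B EZ (E w k) (E w k) \<partial>P)"
    by (intro integral_mono integrable_mult_right integrable_forms EZ B EZ_lower[OF ex]
        err_kernel_orthogonal S_row)
  then show ?thesis by (simp add: second_moment_def)
qed

lemma second_moment_recurrence:
  assumes ex: "exactness n D A B b"
  shows "second_moment (Suc (Suc k))
    \<le> (1 + 3 * \<beta> + 2 * \<beta>\<^sup>2 - (\<omega> * (2 - \<omega>) + \<omega> * \<beta>) * lambda_min_plus W) * second_moment (Suc k)
     + (\<beta> + 2 * \<beta>\<^sup>2 + \<omega> * \<beta> * lambda_max W) * second_moment k"
proof -
  let ?B = "\<lambda>j w. ip_B B (E w j) (E w j)"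
  let ?Z = "\<lambda>j w. ip_B (Z_mat A B (S (Suc k) w)) (E w j) (E w j)"
  let ?z = "\<lambda>j. \<integral>w. ip_B EZ (E w j) (E w j) \<partial>P"
  let ?c1 = "1 + 3 * \<beta> + 2 * \<beta>\<^sup>2" and ?c2 = "\<beta> + 2 * \<beta>\<^sup>2" and ?c3 = "\<omega> * (2 - \<omega>) + \<omega> * \<beta>"
  have iB: "integrable P (?B j)" for j by (rule integrable_forms(1)[OF B(1)])
  have iZ: "integrable P (?Z j)" for j by (rule integrable_forms(2)) simp
  have "second_moment (Suc (Suc k))
    \<le> (\<integral>w. ?c1 * ?B (Suc k) w + ?c2 * ?B k w - ?c3 * ?Z (Suc k) w + \<omega> * \<beta> * ?Z k w \<partial>P)"
    unfolding second_moment_def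
    by (intro integral_mono iB Bochner_Integration.integrable_add
        Bochner_Integration.integrable_diff
        integrable_mult_right iZ err_step S_row) auto
  also have "\<dots> = ?c1 * second_moment (Suc k) + ?c2 * second_moment k - ?c3 * (\<integral>w. ?Z (Suc k) w \<partial>P)
     + \<omega> * \<beta> * (\<integral>w. ?Z k w \<partial>P)"
    unfolding second_moment_def using iB iZ by simp
  also have "\<dots> = ?c1 * second_moment (Suc k) + ?c2 * second_moment k - ?c3 * ?z (Suc k) + \<omega> * \<beta> *
      ?z k"
    using expected_Z_form[of "Suc k" "Suc k"] expected_Z_form[of "Suc k" k] by simp
  also have "\<dots> \<le> ?c1 * second_moment (Suc k) + ?c2 * second_moment k
     - ?c3 * (lambda_min_plus W * second_moment (Suc k)) + \<omega> * \<beta> * (lambda_max W * second_moment k)"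
    using \<omega> \<beta> by (intro add_mono diff_mono order_refl mult_left_mono expected_EZ_lower[OF ex]
        expected_EZ_upper) auto
  finally show ?thesis by (simp add: algebra_simps)
qed

end

section \<open>Linear convergence in mean square\<close>

theorem theorem1:
  fixes m n :: nat and A B :: "real mat" and b x0 x1 xstar :: "real vec"
    and D :: "real mat measure"
    and P :: "'w measure" and S :: "nat \<Rightarrow> 'w \<Rightarrow> real mat"
    and x :: "nat \<Rightarrow> 'w \<Rightarrow> real vec"
    and \<omega> \<beta> lmax lmin a1 a2 q \<delta> :: real
  assumes A: "A \<in> carrier_mat m n" and b: "b \<in> carrier_vec m"
    and consistent: "sol_set n A b \<noteq> {}"
    and B: "spd_mat n B"
    and D: "prob_space D" "sets D = sets (mat_borel m)"
    and W: "W_mat n D A B \<noteq> 0\<^sub>m n n"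
    and lmax: "lmax = lambda_max (W_mat n D A B)"
    and lmin: "lmin = lambda_min_plus (W_mat n D A B)"
    and exact: "exactness n D A B b"
    and P: "prob_space P"
    and indep: "prob_space.indep_vars P (\<lambda>_. mat_borel m) S {1..}"
    and distr: "\<And>k. k \<ge> 1 \<Longrightarrow> distr P (mat_borel m) (S k) = D"
    and x0: "x0 \<in> carrier_vec n" and x1: "x1 = x0"
    and x: "\<And>k w. x k w = msgd A B b \<omega> \<beta> x0 x1 (\<lambda>i. S i w) k"
    and \<omega>: "0 < \<omega>" "\<omega> < 2" and \<beta>: "\<beta> \<ge> 0"
    and a1: "a1 = 1 + 3 * \<beta> + 2 * \<beta>\<^sup>2 - (\<omega> * (2 - \<omega>) + \<omega> * \<beta>) * lmin"
    and a2: "a2 = \<beta> + 2 * \<beta>\<^sup>2 + \<omega> * \<beta> * lmax"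
    and a12: "a1 + a2 < 1"
    and xstar: "xstar = proj_B B (sol_set n A b) x0"
    and q: "q = (a1 + sqrt (a1\<^sup>2 + 4 * a2)) / 2"
    and \<delta>: "\<delta> = q - a1"
  shows "(\<forall>k. integrable P (\<lambda>w. (norm_B B (x (k + 1) w - xstar))\<^sup>2) \<and>
            (\<integral>w. (norm_B B (x (k + 1) w - xstar))\<^sup>2 \<partial>P)
              \<le> q ^ k * (1 + \<delta>) * (norm_B B (x0 - xstar))\<^sup>2)
       \<and> (\<forall>k. integrable P (\<lambda>w. f_full D A B b (x (k + 1) w)) \<and>
            (\<integral>w. f_full D A B b (x (k + 1) w) \<partial>P)
              \<le> q ^ k * (lmax / 2) * (1 + \<delta>) * (norm_B B (x0 - xstar))\<^sup>2)
       \<and> a1 + a2 \<le> q \<and> q < 1"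
proof -
  interpret sk: sketching m n A B by unfold_locales (rule A, rule B)
  obtain y where y: "y \<in> sol_set n A b" using consistent by blast
  have xsL: "xstar \<in> sol_set n A b" unfolding xstar by (rule sk.proj_sol_set(1)[OF y x0])
  interpret sm: sketching_method m n A B b D xstar
  proof (intro sketching_method.intro sketching_method_axioms.intro sk.sketching_axioms D)
    show "xstar \<in> carrier_vec n" "A *\<^sub>v xstar = b" using xsL unfolding sol_set_def by blast+
  qed
  have xs: "xstar \<in> carrier_vec n" by (rule sm.xs)
  have "x0 - xstar \<in> sm.kernel_orthogonal"
    using sk.proj_sol_set(2)[OF y x0] x0 xs by (simp add: sm.kernel_orthogonal_def xstar)
  then interpret run: random_momentum_run m n A B b D xstar \<omega> \<beta> x0 P S
    by (intro random_momentum_run.intro random_momentum_run_axioms.intro momentum_run.intro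
        momentum_run_axioms.intro sm.sketching_method_axioms x0 \<omega> \<beta> P indep distr)
  have err: "x k w - xstar = run.E w k" for k w by (simp add: x x1 run.err_def)
  have xc: "x k w \<in> carrier_vec n" for k w using run.msgd_carrier by (simp add: x x1)
  have nrm: "(norm_B B (x k w - xstar))\<^sup>2 = ip_B B (run.E w k) (run.E w k)" for k w
    unfolding err by (rule norm_B_square[OF B run.err_carrier])
  have nrm0: "(norm_B B (x0 - xstar))\<^sup>2 = run.second_moment 0"
    unfolding run.second_moment_start(1) by (rule norm_B_square[OF B]) (use x0 xs in simp)
  have f: "f_full D A B b (x k w) = ip_B sm.EZ (run.E w k) (run.E w k) / 2" for k w
    unfolding sm.f_full_eq[OF xc] err ..
  have lmax0: "lmax \<ge> 0" unfolding lmax by (rule sm.lambda_max_W_nonneg[OF W])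
  have a20: "a2 \<ge> 0" unfolding a2 using \<beta> \<omega> lmax0 by simp
  note rec = momentum_recurrence[OF a20 a12 run.second_moment_nonneg run.second_moment_start(2) _ q \<delta>]
  have step: "run.second_moment (Suc (Suc k)) \<le> a1 * run.second_moment (Suc k) + a2 * run.second_moment k" for k
    unfolding a1 a2 lmax lmin by (rule run.second_moment_recurrence[OF exact])
  have bound: "run.second_moment (Suc k) \<le> q ^ k * (1 + \<delta>) * run.second_moment 0" for k
    by (rule rec(1)[OF step])
  show ?thesis
  proof (intro conjI allI)
    fix k
    show "integrable P (\<lambda>w. (norm_B B (x (k + 1) w - xstar))\<^sup>2)"
      unfolding nrm by (rule run.integrable_forms(1)[OF sk.B(1)])
    show "(\<integral>w. (norm_B B (x (k + 1) w - xstar))\<^sup>2 \<partial>P) \<le> q ^ k * (1 + \<delta>) * (norm_B B (x0 - xstar))\<^sup>2"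
      unfolding nrm nrm0 using bound[of k] by (simp add: run.second_moment_def)
    show "integrable P (\<lambda>w. f_full D A B b (x (k + 1) w))"
      unfolding f by (intro integrable_divide run.integrable_forms(1)[OF sm.EZ(1)])
    have "(\<integral>w. f_full D A B b (x (k + 1) w) \<partial>P) \<le> lmax * run.second_moment (Suc k) / 2"
      unfolding f using run.expected_EZ_upper[of "Suc k"] by (simp add: lmax)
    also have "\<dots> \<le> lmax * (q ^ k * (1 + \<delta>) * run.second_moment 0) / 2"
      by (intro divide_right_mono mult_left_mono bound lmax0) simp
    finally show "(\<integral>w. f_full D A B b (x (k + 1) w) \<partial>P)
        \<le> q ^ k * (lmax / 2) * (1 + \<delta>) * (norm_B B (x0 - xstar))\<^sup>2"
      unfolding nrm0 by (simp add: mult.commute mult.left_commute)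
  next
    show "a1 + a2 \<le> q" "q < 1" by (rule rec(3)[OF step], rule rec(4)[OF step])
  qed
qed

end
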